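(* Let $R$ be a Prüfer $v$-multiplication domain with quotient field $K$. The following statements are equivalent. (1) Each $t$-flat overring of $R$ is a $t\#$-domain. (2) Each $t$-subintersection of $R$ is a $t\#$-domain. (3) For each set $\Lambda$ of pairwise incomparable $t$-primes of $R$, $\Phi(\Lambda)$ is $v$-finite. (4) If $T$ is a $t$-subintersection of $R$, there exists a unique set $\Lambda$ of pairwise incomparable $t$-primes of $R$ such that $T = R_{\Phi(\Lambda)}$; moreover, $\Lambda = \{M \cap R \mid M \in t\text{-Max}(T)\}$. (5) If $T$ is a $t$-flat overring of $R$ and $T = \bigcap_{Q \in \Lambda} T_Q$ for some set $\Lambda$ of pairwise incomparable $t$-primes of $T$, then $\Lambda = t\text{-Max}(T)$. (6) If $\Lambda \subseteq t\text{-Max}(R)$, then $\Phi(\Lambda)$ is $v$-finite. (7) Each $t$-prime ideal $P$ of $R$ contains a finitely generated ideal which is not contained in any maximal $t$-ideal of $R$ not containing $P$. (8) For each $t$-prime $P$ of $R$, there exists an element $u \in K$ such that $(R:_R u) \subseteq P$ and $(R:_R u) \nsubseteq M$ for each maximal $t$-ideal $M$ of $R$ not containing $P$. (9) For each $t$-prime ideal $P$ of $R$, $R_P \nsupseteq \bigcap R_M$, where $M$ ranges over the set of maximal $t$-ideals of $R$ not containing $P$. (10) Each $t$-linked overring of $R$ is a $t\#$-domain. (11) $(P:P)$ is a $t\#$-domain for each $t$-prime $P$ of $R$.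
   Context: $R$ is an integral domain with quotient field $K$; an overring of $R$ is a ring $T$ with $R \subseteq T \subseteq K$. For a nonzero fractional ideal $I$ of a domain $R$: $I^{-1} = (R:I) = \{x \in K \mid xI \subseteq R\}$, $I_v = (I^{-1})^{-1}$, and $I_t = \bigcup J_v$, the union over all nonzero finitely generated $J \subseteq I$; $I$ is a $t$-ideal if $I = I_t$. A maximal $t$-ideal is an ideal maximal among the proper nonzero integral $t$-ideals; $t\text{-Max}(R)$ is the set of these. A $t$-prime is a (nonzero) prime ideal which is a $t$-ideal. $(R:_R u) = \{r \in R \mid ru \in R\}$ and $(P:P) = \{x \in K \mid xP \subseteq P\}$. Intersections of localizations over the empty set are $K$. $R$ is a Prüfer $v$-multiplication domain (PVMD) if $R_M$ is a valuation domain for each $M \in t\text{-Max}(R)$. A domain $D$ is a $t\#$-domain if $\bigcap_{M \in \mathcal M_1} D_M \neq \bigcap_{M \in \mathcal M_2} D_M$ for any two distinct subsets $\mathcal M_1, \mathcal M_2$ of $t\text{-Max}(D)$. An overring $T$ is $t$-flat over $R$ if $T_M = R_{M \cap R}$ for each $M \in t\text{-Max}(T)$; it is a $t$-subintersection of $R$ if $T = \bigcap R_P$ over some set of $t$-primes $P$ of $R$; it is $t$-linked over $R$ if for each nonzero finitely generated ideal $I$ of $R$ with $(R:I) = R$ one has $(T:IT) = T$. For a set $\Lambda$ of $t$-primes of $R$, $\Phi(\Lambda)$ is the set of all (nonzero, integral) $t$-ideals $I$ of $R$ with $I \nsubseteq P$ for all $P \in \Lambda$, and $R_{\Phi(\Lambda)}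 = \{x \in K \mid xI \subseteq R \text{ for some } I \in \Phi(\Lambda)\} = \bigcap_{P \in \Lambda} R_P$. $\Phi(\Lambda)$ is $v$-finite if each $I \in \Phi(\Lambda)$ contains a finitely generated ideal $J$ with $J_v \in \Phi(\Lambda)$. *)

theory Defs
  imports "HOL-Algebra.Algebraic_Closure_Type"
begin

text \<open>
  The quotient field \<open>K\<close> is the ambient type \<^typ>\<open>'k::field\<close>; the domain \<open>R\<close>, its overrings, its
  fractional ideals and the ideals of its overrings are subsets of that type. Subrings, ideals
  and prime ideals are those of HOL-Algebra, taken in the following ring. In particular an
  intersection over the empty family is \<^const>\<open>UNIV\<close>, that is, \<open>K\<close>.
\<close>

abbreviation ring_on :: "'k::field set \<Rightarrow> 'k ring" where
  "ring_on D \<equiv> ring_of_type_algebra\<lparr>carrier := D\<rparr>"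

definition domain_with_quotient_field :: "'k::field set \<Rightarrow> bool" where
  "domain_with_quotient_field R \<longleftrightarrow>
     subring R (ring_of_type_algebra :: 'k ring) \<and>
     (\<forall>x. \<exists>a\<in>R. \<exists>b\<in>R. b \<noteq> 0 \<and> x = a / b)"

definition overring :: "'k::field set \<Rightarrow> 'k set \<Rightarrow> bool" where
  "overring R T \<longleftrightarrow> subring T (ring_of_type_algebra :: 'k ring) \<and> R \<subseteq> T"

definition valuation_domain :: "'k::field set \<Rightarrow> bool" where
  "valuation_domain V \<longleftrightarrow>
     subring V (ring_of_type_algebra :: 'k ring) \<and> (\<forall>x. x \<noteq> 0 \<longrightarrow> x \<in> V \<or> inverse x \<in> V)"

text \<open>The localization \<open>D\<^sub>P\<close> at a prime \<open>P\<close>, as a subring of \<open>K\<close>.\<close>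

definition localize :: "'k::field set \<Rightarrow> 'k set \<Rightarrow> 'k set" where
  "localize D P = {a / s | a s. a \<in> D \<and> s \<in> D \<and> s \<notin> P}"

text \<open>
  \<open>(A : B)\<close>, computed in \<open>K\<close>. It is used for \<open>(D : I)\<close> with \<open>I\<close> a fractional ideal of \<open>D\<close>, and for
  \<open>(P : P)\<close>.
\<close>

definition colon :: "'k::field set \<Rightarrow> 'k set \<Rightarrow> 'k set" where
  "colon A B = {x. \<forall>y\<in>B. x * y \<in> A}"

text \<open>\<open>(R :\<^sub>R u)\<close>\<close>

definition conductor :: "'k::field set \<Rightarrow> 'k \<Rightarrow> 'k set" where
  "conductor R u = {r \<in> R. r * u \<in> R}"

text \<open>
  The \<open>D\<close>-submodule of \<open>K\<close> generated by \<open>S\<close>. For an ideal \<open>I\<close> of a subring of \<open>T\<close>, the extended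
  ideal \<open>IT\<close> is \<open>span_over T I\<close>.
\<close>

definition span_over :: "'k::field set \<Rightarrow> 'k set \<Rightarrow> 'k set" where
  "span_over D S =
     {(\<Sum>x\<in>F. c x * x) | F c. finite F \<and> F \<subseteq> S \<and> (\<forall>x\<in>F. c x \<in> D)}"

definition fin_gen :: "'k::field set \<Rightarrow> 'k set \<Rightarrow> bool" where
  "fin_gen D J \<longleftrightarrow> (\<exists>F. finite F \<and> J = span_over D F)"

definition v_closure :: "'k::field set \<Rightarrow> 'k set \<Rightarrow> 'k set" where
  "v_closure D I = colon D (colon D I)"

definition t_closure :: "'k::field set \<Rightarrow> 'k set \<Rightarrow> 'k set" where
  "t_closure D I = \<Union>{v_closure D J | J. fin_gen D J \<and> J \<noteq> {0} \<and> J \<subseteq> I}"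

text \<open>Nonzero integral \<open>t\<close>-ideals; \<open>D\<close> itself is one of them.\<close>

definition t_ideal :: "'k::field set \<Rightarrow> 'k set \<Rightarrow> bool" where
  "t_ideal D I \<longleftrightarrow> ideal I (ring_on D) \<and> I \<noteq> {0} \<and> I = t_closure D I"

definition t_prime :: "'k::field set \<Rightarrow> 'k set \<Rightarrow> bool" where
  "t_prime D P \<longleftrightarrow> primeideal P (ring_on D) \<and> t_ideal D P"

definition t_Max :: "'k::field set \<Rightarrow> 'k set set" where
  "t_Max D = {M. t_ideal D M \<and> M \<noteq> D \<and>
                 (\<forall>I. t_ideal D I \<and> I \<noteq> D \<and> M \<subseteq> I \<longrightarrow> I = M)}"

definition PVMD :: "'k::field set \<Rightarrow> bool" where
  "PVMD R \<longleftrightarrow> (\<forall>M\<in>t_Max R. valuation_domain (localize R M))"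

definition t_sharp_domain :: "'k::field set \<Rightarrow> bool" where
  "t_sharp_domain D \<longleftrightarrow>
     (\<forall>\<M>\<^sub>1 \<M>\<^sub>2. \<M>\<^sub>1 \<subseteq> t_Max D \<and> \<M>\<^sub>2 \<subseteq> t_Max D \<and> \<M>\<^sub>1 \<noteq> \<M>\<^sub>2 \<longrightarrow>
        (\<Inter>M\<in>\<M>\<^sub>1. localize D M) \<noteq> (\<Inter>M\<in>\<M>\<^sub>2. localize D M))"

definition t_flat_overring :: "'k::field set \<Rightarrow> 'k set \<Rightarrow> bool" where
  "t_flat_overring R T \<longleftrightarrow>
     overring R T \<and> (\<forall>M\<in>t_Max T. localize T M = localize R (M \<inter> R))"

definition t_subintersection :: "'k::field set \<Rightarrow> 'k set \<Rightarrow> bool" where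
  "t_subintersection R T \<longleftrightarrow>
     (\<exists>\<P>. (\<forall>P\<in>\<P>. t_prime R P) \<and> T = (\<Inter>P\<in>\<P>. localize R P))"

definition t_linked_overring :: "'k::field set \<Rightarrow> 'k set \<Rightarrow> bool" where
  "t_linked_overring R T \<longleftrightarrow>
     overring R T \<and>
     (\<forall>I. ideal I (ring_on R) \<and> I \<noteq> {0} \<and> fin_gen R I \<and> colon R I = R \<longrightarrow>
          colon T (span_over T I) = T)"

definition incomparable_t_primes :: "'k::field set \<Rightarrow> 'k set set \<Rightarrow> bool" where
  "incomparable_t_primes D \<Lambda> \<longleftrightarrow>
     (\<forall>P\<in>\<Lambda>. t_prime D P) \<and> pairwise (\<lambda>P Q. \<not> P \<subseteq> Q \<and> \<not> Q \<subseteq> P) \<Lambda>"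

text \<open>\<open>\<Phi>(\<Lambda>)\<close> and \<open>R\<^bsub>\<Phi>(\<Lambda>)\<^esub>\<close>\<close>

definition Phi :: "'k::field set \<Rightarrow> 'k set set \<Rightarrow> 'k set set" where
  "Phi R \<Lambda> = {I. t_ideal R I \<and> (\<forall>P\<in>\<Lambda>. \<not> I \<subseteq> P)}"

definition ring_of_fractions :: "'k::field set \<Rightarrow> 'k set set \<Rightarrow> 'k set" where
  "ring_of_fractions R \<F> = {x. \<exists>I\<in>\<F>. \<forall>y\<in>I. x * y \<in> R}"

definition v_finite :: "'k::field set \<Rightarrow> 'k set set \<Rightarrow> bool" where
  "v_finite R \<F> \<longleftrightarrow>
     (\<forall>I\<in>\<F>. \<exists>J. ideal J (ring_on R) \<and> J \<noteq> {0} \<and> fin_gen R J \<and> J \<subseteq> I \<and> v_closure R J \<in> \<F>)"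

definition all_equivalent :: "bool list \<Rightarrow> bool" where
  "all_equivalent ps \<longleftrightarrow> (\<forall>p\<in>set ps. \<forall>q\<in>set ps. p \<longleftrightarrow> q)"

end

theory Submission
  imports Defs
begin

text \<open>
  Say that a subset of \<open>R\<close> escapes from a set \<open>\<Lambda>\<close> of primes if it is contained in no member of
  \<open>\<Lambda>\<close>, and that a \<open>t\<close>-prime \<open>Q\<close> is separated from \<open>\<Lambda>\<close> if the intersection of the \<open>R\<^sub>P\<close> with \<open>P \<in>
  \<Lambda>\<close> is not contained in \<open>R\<^sub>Q\<close>. Over a Pruefer \<open>v\<close>-multiplication domain all eleven statements
  are about separation.

  For a \<open>t\<close>-linked overring \<open>T\<close> the maximal \<open>t\<close>-ideals \<open>M\<close> of \<open>T\<close> contract to \<open>t\<close>-primes \<open>Q\<close> of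
  \<open>R\<close>, by \<open>t\<close>-invertibility of finitely generated ideals (\<open>t_linked_contraction_t_prime\<close>), and
  \<open>T\<^sub>M = R\<^sub>Q\<close>, because \<open>R\<^sub>Q\<close> is a valuation domain (\<open>t_linked_localize\<close>). So \<open>t\<close>-linked
  overrings, \<open>t\<close>-flat overrings and \<open>t\<close>-subintersections are the same, and such a \<open>T\<close> is the
  intersection of the \<open>R\<^sub>Q\<close> over the antichain of contractions. It is a \<open>t#\<close>-domain if and only
  if each contraction is separated from the others. In particular (1), (2) and (10) are the same
  statement.

  If a finite subset \<open>F\<close> of \<open>Q\<close> escapes from \<open>\<Lambda>\<close>, then \<open>(R : F)\<close> is contained in every \<open>R\<^sub>P\<close> with
  \<open>P \<in> \<Lambda>\<close> but not in \<open>R\<^sub>Q\<close> (\<open>Inter_localize_not_subset\<close>). As \<open>v\<close>-finiteness of \<open>\<Phi>(\<Lambda>)\<close> says that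
  every \<open>t\<close>-ideal which escapes from \<open>\<Lambda>\<close> does so through a finite subset, (3) implies (10), and
  also the uniqueness statements (4) and (5).

  Statement (9) says that each \<open>t\<close>-prime \<open>P\<close> is separated from the maximal \<open>t\<close>-ideals not
  containing it; (8) says the same with conductors. An element that separates yields a finite
  escape (\<open>exists_finite_subset_conductor\<close>), which is (7). From there Zorn's lemma leads to all
  antichains of \<open>t\<close>-primes (\<open>incomparable_t_primes_finite_escape\<close>), which is (3).

  Conversely, if \<open>P\<close> is not separated from the set \<open>W\<close> of maximal \<open>t\<close>-ideals not containing it,
  the intersection \<open>T\<close> of the \<open>R\<^sub>M\<close> with \<open>M \<in> W\<close> equals \<open>(P : P)\<close> (\<open>colon_self_eq\<close>), and \<open>W\<close> is a
  proper subset of the set of contractions for \<open>T\<close>, because one of these contains \<open>P\<close>. So the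
  single ring \<open>T\<close> refutes (4), (5), (10) and (11) together.
\<close>

section \<open>Subrings and ideals inside a field\<close>

lemma ring_of_type_algebra_simps [simp]:
  "carrier (ring_of_type_algebra :: 'k::field ring) = UNIV"
  "\<zero>\<^bsub>(ring_of_type_algebra :: 'k ring)\<^esub> = 0"
  "\<one>\<^bsub>(ring_of_type_algebra :: 'k ring)\<^esub> = 1"
  "x \<oplus>\<^bsub>(ring_of_type_algebra :: 'k ring)\<^esub> y = x + y"
  "x \<otimes>\<^bsub>(ring_of_type_algebra :: 'k ring)\<^esub> y = x * y"
  by (simp_all add: ring_of_type_algebra_def)

lemma uminus_ring_of_type_algebra [simp]:
  "\<ominus>\<^bsub>(ring_of_type_algebra :: 'k::field ring)\<^esub> x = - x"
proof -
  interpret ring "ring_of_type_algebra :: 'k ring" by (rule ring_from_type_algebra)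
  show ?thesis by (rule minus_equality) auto
qed

lemma subring_iff:
  "subring D (ring_of_type_algebra :: 'k::field ring) \<longleftrightarrow>
     1 \<in> D \<and> (\<forall>x\<in>D. \<forall>y\<in>D. x + y \<in> D \<and> x * y \<in> D) \<and> (\<forall>x\<in>D. - x \<in> D)"
  (is "?L \<longleftrightarrow> ?R")
proof
  assume ?L
  from subringE(3,5,6,7)[OF this] show ?R by simp
next
  interpret ring "ring_of_type_algebra :: 'k ring" by (rule ring_from_type_algebra)
  assume ?R
  then show ?L by (intro subringI) auto
qed

locale quotient_field_domain =
  fixes D :: "'k::field set"
  assumes quotient_field: "domain_with_quotient_field D"
begin

lemma subring: "subring D (ring_of_type_algebra :: 'k ring)"
  using quotient_field by (simp add: domain_with_quotient_field_def)

lemma one_closed [simp]: "1 \<in> D"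
  and add_closed [simp]: "\<lbrakk>x \<in> D; y \<in> D\<rbrakk> \<Longrightarrow> x + y \<in> D"
  and mult_closed [simp]: "\<lbrakk>x \<in> D; y \<in> D\<rbrakk> \<Longrightarrow> x * y \<in> D"
  and uminus_closed [simp]: "x \<in> D \<Longrightarrow> - x \<in> D"
  using subring by (auto simp: subring_iff)

lemma zero_closed [simp]: "0 \<in> D"
  using add_closed[OF one_closed uminus_closed[OF one_closed]] by simp

lemma exists_denominator: "\<exists>s\<in>D. s \<noteq> 0 \<and> s * x \<in> D"
proof -
  obtain a b where "a \<in> D" "b \<in> D" "b \<noteq> 0" "x = a / b"
    using quotient_field unfolding domain_with_quotient_field_def by blast
  then show ?thesis by (intro bexI[of _ b]) auto
qed

lemma cring_ring_on: "cring (ring_on D)"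
proof -
  interpret K: cring "ring_of_type_algebra :: 'k ring" by (rule cring_from_type_algebra)
  show ?thesis
    using K.subcring_iff[of D] K.subcringI'[OF subring] by simp
qed

lemma ideal_iff:
  "ideal I (ring_on D) \<longleftrightarrow>
     I \<subseteq> D \<and> 0 \<in> I \<and> (\<forall>x\<in>I. \<forall>y\<in>I. x + y \<in> I) \<and> (\<forall>r\<in>D. \<forall>x\<in>I. r * x \<in> I)"
  (is "?L \<longleftrightarrow> ?R")
proof
  assume ?L
  then interpret I: ideal I "ring_on D" .
  show ?R
    using I.a_subset additive_subgroup.zero_closed[OF I.is_additive_subgroup]
      additive_subgroup.a_closed[OF I.is_additive_subgroup] I.I_l_closed by auto
next
  assume R: ?R
  interpret C: cring "ring_on D" by (rule cring_ring_on)
  have minus: "- x \<in> I" if "x \<in> I" for x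
    using R that uminus_closed[OF one_closed] by (metis mult_minus1)
  have inv: "\<ominus>\<^bsub>ring_on D\<^esub> x = - x" if "x \<in> D" for x
    by (rule C.minus_equality) (use that in auto)
  show ?L
  proof (rule idealI)
    show "subgroup I (add_monoid (ring_on D))"
    proof (rule C.add.subgroupI)
      show "\<ominus>\<^bsub>ring_on D\<^esub> x \<in> I" if "x \<in> I" for x
        using inv[of x] minus[OF that] that R by auto
    qed (use R in auto)
    show "x \<otimes>\<^bsub>ring_on D\<^esub> a \<in> I" "a \<otimes>\<^bsub>ring_on D\<^esub> x \<in> I"
      if "a \<in> I" "x \<in> carrier (ring_on D)" for a x
      using R that by (simp_all, metis mult.commute)
  qed (rule C.ring_axioms)
qed

lemma primeideal_iff:
  "primeideal P (ring_on D) \<longleftrightarrow>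
     ideal P (ring_on D) \<and> 1 \<notin> P \<and> (\<forall>a\<in>D. \<forall>b\<in>D. a * b \<in> P \<longrightarrow> a \<in> P \<or> b \<in> P)"
  (is "?L \<longleftrightarrow> ?R")
proof
  assume ?L
  then interpret P: primeideal P "ring_on D" .
  show ?R
    using P.is_ideal P.I_notcarr P.I_prime P.one_imp_carrier by auto
next
  assume ?R
  then show ?L
    using cring_ring_on by (intro primeidealI) auto
qed

lemma ideal_subset: "ideal I (ring_on D) \<Longrightarrow> x \<in> I \<Longrightarrow> x \<in> D"
  and ideal_zero: "ideal I (ring_on D) \<Longrightarrow> 0 \<in> I"
  and ideal_add: "ideal I (ring_on D) \<Longrightarrow> x \<in> I \<Longrightarrow> y \<in> I \<Longrightarrow> x + y \<in> I"
  and ideal_mult: "ideal I (ring_on D) \<Longrightarrow> r \<in> D \<Longrightarrow> x \<in> I \<Longrightarrow> r * x \<in> I"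
  by (auto simp: ideal_iff)

lemma ideal_one: "ideal I (ring_on D) \<Longrightarrow> 1 \<in> I \<Longrightarrow> I = D"
  unfolding ideal_iff by (metis mult.right_neutral subsetI subset_antisym)

lemma prime_ideal: "primeideal P (ring_on D) \<Longrightarrow> ideal P (ring_on D)"
  and prime_one: "primeideal P (ring_on D) \<Longrightarrow> 1 \<notin> P"
  and prime_mult: "primeideal P (ring_on D) \<Longrightarrow> a \<in> D \<Longrightarrow> b \<in> D \<Longrightarrow> a * b \<in> P \<Longrightarrow> a \<in> P \<or> b \<in> P"
  by (auto simp: primeideal_iff)

lemma ideal_sum:
  assumes "ideal I (ring_on D)"
  shows "finite F \<Longrightarrow> (\<And>x. x \<in> F \<Longrightarrow> f x \<in> I) \<Longrightarrow> sum f F \<in> I"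
  by (induction F rule: finite_induct) (auto intro: ideal_zero[OF assms] ideal_add[OF assms])

lemma ideal_domain: "ideal D (ring_on D)"
  by (simp add: ideal_iff)

section \<open>Spans, colons and divisorial closure\<close>

lemma subset_span_over: "S \<subseteq> span_over D S"
proof
  fix x assume "x \<in> S"
  then have "(\<Sum>y\<in>{x}. (\<lambda>_. 1) y * y) \<in> span_over D S"
    unfolding span_over_def by (intro CollectI exI[of _ "{x}"] exI[of _ "\<lambda>_. 1"]) auto
  then show "x \<in> span_over D S" by simp
qed

lemma span_over_subset_iff:
  assumes "ideal I (ring_on D)"
  shows "span_over D S \<subseteq> I \<longleftrightarrow> S \<subseteq> I"
proof
  assume "S \<subseteq> I"
  then show "span_over D S \<subseteq> I"
    using assms by (auto simp: span_over_def intro!: ideal_sum[OF assms] ideal_mult[OF assms])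
qed (use subset_span_over in blast)

lemma ideal_span_over:
  assumes S: "S \<subseteq> D"
  shows "ideal (span_over D S) (ring_on D)"
  unfolding ideal_iff
proof (intro conjI ballI)
  show "span_over D S \<subseteq> D"
    using span_over_subset_iff[OF ideal_domain] S by blast
  show "0 \<in> span_over D S"
    unfolding span_over_def by (intro CollectI exI[of _ "{}"]) auto
next
  fix x y assume "x \<in> span_over D S" "y \<in> span_over D S"
  then obtain F c G d where
      F: "finite F" "F \<subseteq> S" "\<forall>x\<in>F. c x \<in> D" "x = (\<Sum>x\<in>F. c x * x)" and
      G: "finite G" "G \<subseteq> S" "\<forall>x\<in>G. d x \<in> D" "y = (\<Sum>x\<in>G. d x * x)"
    unfolding span_over_def by blast
  define e where "e z = (if z \<in> F then c z else 0) + (if z \<in> G then d z else 0)" for z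
  have "x = (\<Sum>z\<in>F \<union> G. if z \<in> F then c z * z else 0)"
    using F G by (simp add: sum.If_cases Int_absorb1 Un_commute)
  moreover have "y = (\<Sum>z\<in>F \<union> G. if z \<in> G then d z * z else 0)"
    using F G by (simp add: sum.If_cases Int_absorb1 Un_commute)
  ultimately have "x + y = (\<Sum>z\<in>F \<union> G. e z * z)"
    unfolding e_def by (simp add: sum.distrib[symmetric] distrib_right if_distrib cong: if_cong)
       (intro sum.cong, auto simp: distrib_right)
  moreover have "\<forall>z\<in>F \<union> G. e z \<in> D" using F G by (auto simp: e_def)
  ultimately show "x + y \<in> span_over D S"
    using F G unfolding span_over_def by blast
next
  fix r x assume r: "r \<in> D" and "x \<in> span_over D S"
  then obtain F c where F: "finite F" "F \<subseteq> S" "\<forall>x\<in>F. c x \<in> D" "x = (\<Sum>x\<in>F. c x * x)"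
    unfolding span_over_def by blast
  have "r * x = (\<Sum>x\<in>F. (r * c x) * x)"
    by (simp add: F sum_distrib_left mult.assoc)
  moreover have "\<forall>x\<in>F. r * c x \<in> D" using F r by auto
  ultimately show "r * x \<in> span_over D S" using F unfolding span_over_def
    by (intro CollectI exI[of _ F] exI[of _ "\<lambda>x. r * c x"]) simp
qed

lemma colon_mult_left: "r \<in> D \<Longrightarrow> x \<in> colon D A \<Longrightarrow> r * x \<in> colon D A"
  by (auto simp: colon_def mult.assoc)

lemma colon_add: "x \<in> colon D A \<Longrightarrow> y \<in> colon D A \<Longrightarrow> x + y \<in> colon D A"
  by (auto simp: colon_def distrib_right)

lemma subset_v_closure: "A \<subseteq> v_closure D A"
  by (auto simp: v_closure_def colon_def mult.commute)

lemma v_closure_mono: "A \<subseteq> B \<Longrightarrow> v_closure D A \<subseteq> v_closure D B"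
  by (auto simp: v_closure_def colon_def)

lemma v_closure_least: "A \<subseteq> v_closure D B \<Longrightarrow> v_closure D A \<subseteq> v_closure D B"
proof
  fix x assume A: "A \<subseteq> v_closure D B" and x: "x \<in> v_closure D A"
  have "y \<in> colon D A" if "y \<in> colon D B" for y
    using A that by (auto simp: v_closure_def colon_def mult.commute[of y])
  then show "x \<in> v_closure D B" using x by (simp add: v_closure_def colon_def)
qed

lemma v_closure_subset_domain: "A \<subseteq> D \<Longrightarrow> v_closure D A \<subseteq> D"
proof
  fix x assume "A \<subseteq> D" and x: "x \<in> v_closure D A"
  then have "1 \<in> colon D A" by (auto simp: colon_def)
  then have "x * 1 \<in> D" using x unfolding v_closure_def colon_def by blast
  then show "x \<in> D" by simp
qed

lemma v_closure_scale:
  assumes "x \<in> v_closure D A"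
  shows "c * x \<in> v_closure D ((*) c ` A)"
  using assms by (auto simp: v_closure_def colon_def) (metis mult.assoc mult.commute)

lemma ideal_v_closure: "A \<subseteq> D \<Longrightarrow> ideal (v_closure D A) (ring_on D)"
  using v_closure_subset_domain[of A]
  by (auto simp: ideal_iff v_closure_def colon_mult_left colon_add) (simp add: colon_def)

lemma one_mem_v_closure_iff:
  assumes "A \<subseteq> D" 
  shows "1 \<in> v_closure D A \<longleftrightarrow> colon D A = D"
proof -
  have "D \<subseteq> colon D A" using assms by (auto simp: colon_def)
  moreover have "1 \<in> v_closure D A \<longleftrightarrow> colon D A \<subseteq> D"
    by (auto simp: v_closure_def colon_def[of D "colon D A"])
  ultimately show ?thesis by blast
qed

lemma colon_span_over:
  assumes T: "quotient_field_domain T" "D \<subseteq> T"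
  shows "colon T (span_over D S) = colon T S"
proof
  interpret T: quotient_field_domain T by fact
  show "colon T (span_over D S) \<subseteq> colon T S"
    using subset_span_over by (auto simp: colon_def)
  show "colon T S \<subseteq> colon T (span_over D S)"
  proof
    fix x assume x: "x \<in> colon T S"
    have "x * (\<Sum>y\<in>F. c y * y) \<in> T" if "finite F" "F \<subseteq> S" "\<forall>y\<in>F. c y \<in> D" for F c
    proof -
      have "x * (\<Sum>y\<in>F. c y * y) = (\<Sum>y\<in>F. c y * (x * y))"
        by (simp add: sum_distrib_left algebra_simps)
      also have "\<dots> \<in> T"
        using that x T(2) by (intro T.ideal_sum[OF T.ideal_domain]) (auto simp: colon_def subset_iff)
      finally show ?thesis .
    qed
    then show "x \<in> colon T (span_over D S)" by (auto simp: colon_def span_over_def)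
  qed
qed

lemma v_closure_span_over: "v_closure D (span_over D S) = v_closure D S"
  by (simp add: v_closure_def colon_span_over quotient_field_domain_axioms)

section \<open>\<open>t\<close>-ideals\<close>

text \<open>
  A finitely generated ideal and a finite generating set have the same divisorial closure, so
  \<open>t\<close>-ideals are described below by finite subsets \<open>F\<close>. The condition that \<open>F\<close> has a nonzero
  element is there for the case that \<open>D\<close> is a field: then, and only then, the divisorial closure
  of zero is not zero.
\<close>

lemma span_over_eq_zero_iff: "span_over D F = {0} \<longleftrightarrow> F \<subseteq> {0}"
proof -
  have "0 \<in> span_over D F"
    unfolding span_over_def by (intro CollectI exI[of _ "{}"]) auto
  moreover have "ideal {0} (ring_on D)" by (simp add: ideal_iff)
  ultimately show ?thesis using span_over_subset_iff[of "{0}" F] by auto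
qed

lemma mem_t_closure_iff:
  assumes I: "ideal I (ring_on D)"
  shows "x \<in> t_closure D I \<longleftrightarrow> (\<exists>F. finite F \<and> F \<subseteq> I \<and> \<not> F \<subseteq> {0} \<and> x \<in> v_closure D F)"
proof
  assume "x \<in> t_closure D I"
  then obtain F where "finite F" "span_over D F \<noteq> {0}" "span_over D F \<subseteq> I"
      "x \<in> v_closure D (span_over D F)"
    unfolding t_closure_def fin_gen_def by blast
  then show "\<exists>F. finite F \<and> F \<subseteq> I \<and> \<not> F \<subseteq> {0} \<and> x \<in> v_closure D F"
    by (auto simp: span_over_subset_iff[OF I] v_closure_span_over span_over_eq_zero_iff)
next
  assume "\<exists>F. finite F \<and> F \<subseteq> I \<and> \<not> F \<subseteq> {0} \<and> x \<in> v_closure D F"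
  then obtain F where F: "finite F" "F \<subseteq> I" "\<not> F \<subseteq> {0}" "x \<in> v_closure D F" by blast
  then have "fin_gen D (span_over D F) \<and> span_over D F \<noteq> {0} \<and> span_over D F \<subseteq> I"
    by (auto simp: fin_gen_def span_over_subset_iff[OF I] span_over_eq_zero_iff)
  then show "x \<in> t_closure D I"
    using F(4) v_closure_span_over unfolding t_closure_def by blast
qed

lemma subset_t_closure:
  assumes I: "ideal I (ring_on D)" "I \<noteq> {0}"
  shows "I \<subseteq> t_closure D I"
proof
  fix x assume x: "x \<in> I"
  obtain a where a: "a \<in> I" "a \<noteq> 0" using I ideal_zero by blast
  have "x \<in> v_closure D {a, x}" using subset_v_closure by blast
  then show "x \<in> t_closure D I"
    using x a unfolding mem_t_closure_iff[OF I(1)] by (intro exI[of _ "{a, x}"]) auto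
qed

lemma t_ideal_iff:
  "t_ideal D I \<longleftrightarrow> ideal I (ring_on D) \<and> I \<noteq> {0} \<and>
     (\<forall>F. finite F \<and> F \<subseteq> I \<and> \<not> F \<subseteq> {0} \<longrightarrow> v_closure D F \<subseteq> I)"
proof (cases "ideal I (ring_on D) \<and> I \<noteq> {0}")
  case True
  have "I = t_closure D I \<longleftrightarrow> t_closure D I \<subseteq> I" using subset_t_closure True by blast
  also have "\<dots> \<longleftrightarrow> (\<forall>F. finite F \<and> F \<subseteq> I \<and> \<not> F \<subseteq> {0} \<longrightarrow> v_closure D F \<subseteq> I)"
    unfolding subset_iff[of "t_closure D I"] subset_iff[of "v_closure D _"] mem_t_closure_iff[OF conjunct1[OF True]]
    by metis
  finally show ?thesis using True by (simp add: t_ideal_def)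
qed (auto simp: t_ideal_def)

lemma t_ideal_ideal: "t_ideal D I \<Longrightarrow> ideal I (ring_on D)"
  by (simp add: t_ideal_def)

lemma t_ideal_nonzero: "t_ideal D I \<Longrightarrow> \<exists>x\<in>I. x \<noteq> 0"
  using ideal_zero by (auto simp: t_ideal_def)

lemma t_ideal_v_closure:
  "t_ideal D I \<Longrightarrow> finite F \<Longrightarrow> F \<subseteq> I \<Longrightarrow> \<not> F \<subseteq> {0} \<Longrightarrow> v_closure D F \<subseteq> I"
  by (simp add: t_ideal_iff)

lemma t_ideal_v_closure_finite:
  assumes "finite F" "F \<subseteq> D" "\<not> F \<subseteq> {0}"
  shows "t_ideal D (v_closure D F)"
  using assms subset_v_closure[of F] by (auto simp: t_ideal_iff ideal_v_closure v_closure_least)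

text \<open>
  The transporter \<open>(I :\<^sub>D S)\<close> is the intersection of \<open>D\<close> with the multiples \<open>s\<^sup>-\<^sup>1I\<close>, and
  divisorial closure commutes with multiplication by \<open>s\<close>. That transporters of \<open>t\<close>-ideals are
  \<open>t\<close>-ideals is what makes \<open>t\<close>-ideals that are maximal for some property prime.
\<close>

lemma t_ideal_transporter:
  assumes I: "t_ideal D I" and S: "S \<subseteq> D"
  shows "t_ideal D {r \<in> D. \<forall>s\<in>S. s * r \<in> I}"
  unfolding t_ideal_iff
proof (intro conjI allI impI)
  note II = t_ideal_ideal[OF I]
  show "ideal {r \<in> D. \<forall>s\<in>S. s * r \<in> I} (ring_on D)"
    using II S unfolding ideal_iff
    by (auto simp: distrib_left mult.left_commute)
  obtain a where "a \<in> I" "a \<noteq> 0" using t_ideal_nonzero[OF I] by blast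
  then have "a \<in> {r \<in> D. \<forall>s\<in>S. s * r \<in> I}"
    using S ideal_mult[OF II] ideal_subset[OF II] by blast
  then show "{r \<in> D. \<forall>s\<in>S. s * r \<in> I} \<noteq> {0}" using \<open>a \<noteq> 0\<close> by blast
  fix F assume F: "finite F \<and> F \<subseteq> {r \<in> D. \<forall>s\<in>S. s * r \<in> I} \<and> \<not> F \<subseteq> {0}"
  have "s * x \<in> I" if "x \<in> v_closure D F" "s \<in> S" for x s
  proof (cases "s = 0")
    case False
    then have "v_closure D ((*) s ` F) \<subseteq> I"
      using F that by (intro t_ideal_v_closure[OF I]) auto
    then show ?thesis using v_closure_scale[OF that(1), of s] by blast
  qed (use ideal_zero[OF II] in simp)
  then show "v_closure D F \<subseteq> {r \<in> D. \<forall>s\<in>S. s * r \<in> I}"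
    using v_closure_subset_domain[of F] F by blast
qed

text \<open>
  For \<open>u \<noteq> 0\<close> the conductor is \<open>D \<inter> u\<^sup>-\<^sup>1D\<close>, an intersection of two divisorial fractional ideals.
\<close>

lemma t_ideal_conductor: "t_ideal D (conductor D u)"
  unfolding t_ideal_iff
proof (intro conjI allI impI)
  show "ideal (conductor D u) (ring_on D)"
    by (auto simp: ideal_iff conductor_def distrib_right mult.assoc)
  show "conductor D u \<noteq> {0}"
    using exists_denominator[of u] by (auto simp: conductor_def)
  fix F assume F: "finite F \<and> F \<subseteq> conductor D u \<and> \<not> F \<subseteq> {0}"
  then have "F \<subseteq> D" "u \<in> colon D F" by (auto simp: conductor_def colon_def mult.commute)
  then have "x * u \<in> D" "x \<in> D" if "x \<in> v_closure D F" for x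
    using that v_closure_subset_domain[of F] by (auto simp: v_closure_def colon_def[of D "colon D F"])
  then show "v_closure D F \<subseteq> conductor D u" unfolding conductor_def by blast
qed

lemma t_ideal_t_closure:
  assumes I: "ideal I (ring_on D)" "I \<noteq> {0}"
  shows "t_ideal D (t_closure D I)"
proof -
  let ?N = "{F. finite F \<and> F \<subseteq> I \<and> \<not> F \<subseteq> {0}}"
  have eq: "t_closure D I = (\<Union>F\<in>?N. v_closure D F)"
    unfolding set_eq_iff mem_t_closure_iff[OF I(1)] by blast
  have sub: "F \<in> ?N \<Longrightarrow> F \<subseteq> D" for F using I(1) by (auto simp: ideal_iff)
  obtain a where a: "a \<in> I" "a \<noteq> 0" using I ideal_zero by blast
  then have aN: "{a} \<in> ?N" by auto
  \<comment> \<open>the union is directed\<close>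
  have dir: "\<exists>G\<in>?N. F \<subseteq> v_closure D G" if "finite F" "F \<subseteq> t_closure D I" for F
    using that
  proof (induction F rule: finite_induct)
    case (insert x F)
    obtain G where G: "G \<in> ?N" "F \<subseteq> v_closure D G" using insert by auto
    obtain H where H: "H \<in> ?N" "x \<in> v_closure D H" using insert.prems unfolding eq by auto
    have "insert x F \<subseteq> v_closure D (G \<union> H)"
      using G(2) H(2) v_closure_mono[of G "G \<union> H"] v_closure_mono[of H "G \<union> H"] by auto
    moreover have "G \<union> H \<in> ?N" using G(1) H(1) by auto
    ultimately show ?case by blast
  qed (use aN in blast)
  show ?thesis
    unfolding t_ideal_iff
  proof (intro conjI allI impI)
    show "ideal (t_closure D I) (ring_on D)"
      unfolding ideal_iff
    proof (intro conjI ballI)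
      show "t_closure D I \<subseteq> D" using v_closure_subset_domain sub unfolding eq by blast
      show "0 \<in> t_closure D I"
        using aN ideal_zero[OF ideal_v_closure[of "{a}"]] sub unfolding eq by blast
    next
      fix x y assume "x \<in> t_closure D I" "y \<in> t_closure D I"
      then obtain G where "G \<in> ?N" "x \<in> v_closure D G" "y \<in> v_closure D G"
        using dir[of "{x, y}"] by auto
      then show "x + y \<in> t_closure D I"
        unfolding eq using ideal_add[OF ideal_v_closure[OF sub]] by blast
    next
      fix r x assume "r \<in> D" "x \<in> t_closure D I"
      then show "r * x \<in> t_closure D I"
        unfolding eq using ideal_mult[OF ideal_v_closure[OF sub]] by blast
    qed
    show "t_closure D I \<noteq> {0}"
      using a subset_t_closure[OF I] by blast
    fix F assume "finite F \<and> F \<subseteq> t_closure D I \<and> \<not> F \<subseteq> {0}"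
    then obtain G where "G \<in> ?N" "F \<subseteq> v_closure D G" using dir[of F] by blast
    then show "v_closure D F \<subseteq> t_closure D I"
      unfolding eq using v_closure_least[of F G] UN_upper[of G ?N "v_closure D"] by simp
  qed
qed

text \<open>
  Being a \<open>t\<close>-ideal is a condition on finite subsets, and a finite subset of the union of a chain
  lies in a member of the chain. The two applications of Zorn's lemma below rest on this.
\<close>

lemma t_ideal_Union_chain:
  assumes chain: "subset.chain \<A> \<C>" and t: "\<And>I. I \<in> \<A> \<Longrightarrow> t_ideal D I" and ne: "\<C> \<noteq> {}"
  shows "t_ideal D (\<Union>\<C>)"
  unfolding t_ideal_iff
proof (intro conjI allI impI)
  have C: "t_ideal D I" if "I \<in> \<C>" for I
    using chain t that by (auto simp: subset.chain_def)
  have comp: "I \<subseteq> J \<or> J \<subseteq> I" if "I \<in> \<C>" "J \<in> \<C>" for I J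
    using chain that by (auto simp: subset.chain_def)
  show "ideal (\<Union>\<C>) (ring_on D)"
    unfolding ideal_iff
  proof (intro conjI ballI)
    show "\<Union>\<C> \<subseteq> D" using C t_ideal_ideal ideal_subset by blast
    show "0 \<in> \<Union>\<C>" using C t_ideal_ideal ideal_zero ne by blast
    show "x + y \<in> \<Union>\<C>" if "x \<in> \<Union>\<C>" "y \<in> \<Union>\<C>" for x y
    proof -
      obtain I where "I \<in> \<C>" "x \<in> I" "y \<in> I" using \<open>x \<in> \<Union>\<C>\<close> \<open>y \<in> \<Union>\<C>\<close> comp by blast
      then show ?thesis using ideal_add[OF t_ideal_ideal[OF C]] by blast
    qed
    show "r * x \<in> \<Union>\<C>" if "r \<in> D" "x \<in> \<Union>\<C>" for r x
      using that ideal_mult[OF t_ideal_ideal[OF C]] by blast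
  qed
  show "\<Union>\<C> \<noteq> {0}" using ne C t_ideal_nonzero by fastforce
  fix F assume F: "finite F \<and> F \<subseteq> \<Union>\<C> \<and> \<not> F \<subseteq> {0}"
  obtain I where "I \<in> \<C>" "F \<subseteq> I"
    using F finite_subset_Union_chain[of F \<C> \<A>] chain ne by blast
  then show "v_closure D F \<subseteq> \<Union>\<C>" using C t_ideal_v_closure F by blast
qed

section \<open>Maximal \<open>t\<close>-ideals\<close>

lemma t_Max_t_ideal: "M \<in> t_Max D \<Longrightarrow> t_ideal D M"
  by (simp add: t_Max_def)

lemma t_Max_one: "M \<in> t_Max D \<Longrightarrow> 1 \<notin> M"
  using ideal_one t_ideal_ideal by (auto simp: t_Max_def)

lemma t_Max_maximal: "M \<in> t_Max D \<Longrightarrow> t_ideal D I \<Longrightarrow> M \<subseteq> I \<Longrightarrow> 1 \<notin> I \<Longrightarrow> I = M"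
  by (auto simp: t_Max_def)

lemma exists_t_Max:
  assumes I: "t_ideal D I" "1 \<notin> I"
  shows "\<exists>M\<in>t_Max D. I \<subseteq> M"
proof -
  define \<A> where "\<A> = {J. t_ideal D J \<and> 1 \<notin> J \<and> I \<subseteq> J}"
  have "\<exists>M\<in>\<A>. \<forall>J\<in>\<A>. M \<subseteq> J \<longrightarrow> J = M"
  proof (rule subset_Zorn_nonempty)
    show "\<A> \<noteq> {}" using I by (auto simp: \<A>_def)
    fix \<C> assume ne: "\<C> \<noteq> {}" and chain: "subset.chain \<A> \<C>"
    have "t_ideal D (\<Union>\<C>)"
      by (rule t_ideal_Union_chain[OF chain _ ne]) (simp add: \<A>_def)
    moreover have "\<C> \<subseteq> \<A>" using chain by (simp add: subset.chain_def)
    ultimately show "\<Union>\<C> \<in> \<A>" using ne by (auto simp: \<A>_def)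
  qed
  then obtain M where M: "M \<in> \<A>" "\<And>J. J \<in> \<A> \<Longrightarrow> M \<subseteq> J \<Longrightarrow> J = M" by blast
  have "J = M" if "t_ideal D J" "J \<noteq> D" "M \<subseteq> J" for J
    using that M ideal_one[OF t_ideal_ideal[OF that(1)]] by (auto simp: \<A>_def)
  then have "M \<in> t_Max D" using M(1) unfolding t_Max_def by (auto simp: \<A>_def)
  then show ?thesis using M(1) by (auto simp: \<A>_def)
qed

text \<open>If \<open>ab \<in> M\<close> and \<open>a \<notin> M\<close>, then \<open>(M :\<^sub>D a)\<close> is a proper \<open>t\<close>-ideal containing \<open>M\<close> and \<open>b\<close>.\<close>

lemma t_Max_t_prime:
  assumes M: "M \<in> t_Max D"
  shows "t_prime D M"
proof -
  have "b \<in> M" if ab: "a \<in> D" "b \<in> D" "a * b \<in> M" and a: "a \<notin> M" for a b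
  proof -
    let ?J = "{r \<in> D. \<forall>s\<in>{a}. s * r \<in> M}"
    note MI = t_ideal_ideal[OF t_Max_t_ideal[OF M]]
    have "t_ideal D ?J" using t_ideal_transporter[OF t_Max_t_ideal[OF M], of "{a}"] ab by simp
    moreover have "M \<subseteq> ?J" using ideal_mult[OF MI] ideal_subset[OF MI] ab by auto
    moreover have "1 \<notin> ?J" using a by auto
    ultimately have "?J = M" by (rule t_Max_maximal[OF M])
    then show ?thesis using ab by blast
  qed
  then show ?thesis
    using t_Max_t_ideal[OF M] t_Max_one[OF M] t_ideal_ideal[OF t_Max_t_ideal[OF M]]
    unfolding t_prime_def primeideal_iff by blast
qed

lemma t_Max_subset_imp_eq: "M \<in> t_Max D \<Longrightarrow> N \<in> t_Max D \<Longrightarrow> M \<subseteq> N \<Longrightarrow> M = N"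
  using t_Max_maximal t_Max_t_ideal t_Max_one by blast

lemma t_prime_prime: "t_prime D P \<Longrightarrow> primeideal P (ring_on D)"
  and t_prime_t_ideal: "t_prime D P \<Longrightarrow> t_ideal D P"
  by (simp_all add: t_prime_def)

lemma t_prime_subset_t_Max: "t_prime D P \<Longrightarrow> \<exists>M\<in>t_Max D. P \<subseteq> M"
  using exists_t_Max t_prime_t_ideal t_prime_prime prime_one by blast

text \<open>
  The \<open>t\<close>-closure of \<open>I\<close> is a \<open>t\<close>-ideal contained in no maximal \<open>t\<close>-ideal, so it contains \<open>1\<close>.
\<close>

lemma exists_finite_v_closure_one:
  assumes I: "ideal I (ring_on D)" "I \<noteq> {0}" and M: "\<And>M. M \<in> t_Max D \<Longrightarrow> \<not> I \<subseteq> M"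
  shows "\<exists>B. finite B \<and> B \<subseteq> I \<and> \<not> B \<subseteq> {0} \<and> 1 \<in> v_closure D B"
proof -
  have "1 \<in> t_closure D I"
    using exists_t_Max[OF t_ideal_t_closure[OF I]] M subset_t_closure[OF I] by blast
  then show ?thesis using mem_t_closure_iff[OF I(1)] by blast
qed

section \<open>Localization\<close>

lemma mem_localize_iff:
  assumes "ideal P (ring_on D)"
  shows "x \<in> localize D P \<longleftrightarrow> (\<exists>s\<in>D. s \<notin> P \<and> s * x \<in> D)"
proof
  assume "x \<in> localize D P"
  then obtain a s where "a \<in> D" "s \<in> D" "s \<notin> P" "x = a / s" unfolding localize_def by blast
  moreover have "s \<noteq> 0" using assms calculation ideal_zero by blast
  ultimately show "\<exists>s\<in>D. s \<notin> P \<and> s * x \<in> D" by (intro bexI[of _ s]) auto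
next
  assume "\<exists>s\<in>D. s \<notin> P \<and> s * x \<in> D"
  then obtain s where s: "s \<in> D" "s \<notin> P" "s * x \<in> D" by blast
  moreover have "s \<noteq> 0" using assms s ideal_zero by blast
  ultimately show "x \<in> localize D P"
    unfolding localize_def by (intro CollectI exI[of _ "s * x"] exI[of _ s]) auto
qed

lemma mem_localize_iff_conductor:
  "ideal P (ring_on D) \<Longrightarrow> x \<in> localize D P \<longleftrightarrow> \<not> conductor D x \<subseteq> P"
  by (auto simp: mem_localize_iff conductor_def)

lemma overring_domain:
  assumes "overring D T" shows "quotient_field_domain T"
  using assms quotient_field
  by (auto simp: quotient_field_domain_def overring_def domain_with_quotient_field_def) (meson subset_iff)

lemma subset_localize: "primeideal P (ring_on D) \<Longrightarrow> D \<subseteq> localize D P"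
  using prime_one prime_ideal by (auto simp: mem_localize_iff intro!: bexI[of _ 1])

lemma localize_antimono:
  "primeideal P (ring_on D) \<Longrightarrow> primeideal Q (ring_on D) \<Longrightarrow> P \<subseteq> Q \<Longrightarrow> localize D Q \<subseteq> localize D P"
  unfolding localize_def by blast

lemma overring_localize:
  assumes P: "primeideal P (ring_on D)"
  shows "overring D (localize D P)"
  unfolding overring_def subring_iff
proof (intro conjI ballI)
  note iff = mem_localize_iff[OF prime_ideal[OF P]]
  show "D \<subseteq> localize D P" by (rule subset_localize[OF P])
  then show "1 \<in> localize D P" by auto
  fix x assume x: "x \<in> localize D P"
  then obtain s where s: "s \<in> D" "s \<notin> P" "s * x \<in> D" using iff by blast
  then show "- x \<in> localize D P" unfolding iff by (intro bexI[of _ s]) auto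
  fix y assume "y \<in> localize D P"
  then obtain t where t: "t \<in> D" "t \<notin> P" "t * y \<in> D" using iff by blast
  have st: "s * t \<in> D" "s * t \<notin> P" using s t prime_mult[OF P] by auto
  have "(s * t) * (x + y) = t * (s * x) + s * (t * y)" "(s * t) * (x * y) = (s * x) * (t * y)"
    by (simp_all add: algebra_simps)
  then show "x + y \<in> localize D P" "x * y \<in> localize D P"
    using st s t unfolding iff by (metis add_closed mult_closed)+
qed

lemma localize_common_denominator:
  assumes P: "primeideal P (ring_on D)" and "finite F" "F \<subseteq> localize D P"
  shows "\<exists>s\<in>D. s \<notin> P \<and> (\<forall>x\<in>F. s * x \<in> D)"
  using assms(2,3)
proof (induction F rule: finite_induct)
  case empty
  then show ?case using prime_one[OF P] by auto
next
  case (insert x F)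
  then obtain s t where "s \<in> D" "s \<notin> P" "\<forall>x\<in>F. s * x \<in> D" "t \<in> D" "t \<notin> P" "t * x \<in> D"
    using mem_localize_iff[OF prime_ideal[OF P]] by auto
  then have "s * t \<in> D" "s * t \<notin> P" "\<forall>y\<in>F. (t * s) * y \<in> D" "s * t * x \<in> D"
    using prime_mult[OF P] by (auto simp: mult.assoc)
  then show ?case by (metis insert_iff mult.commute)
qed

lemma localize_subset_imp:
  assumes P: "primeideal P (ring_on D)" and Q: "primeideal Q (ring_on D)"
    and sub: "localize D P \<subseteq> localize D Q"
  shows "Q \<subseteq> P"
proof
  fix x assume x: "x \<in> Q"
  show "x \<in> P"
  proof (rule ccontr)
    assume "x \<notin> P"
    have xD: "x \<in> D" using x ideal_subset prime_ideal[OF Q] by blast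
    have "x \<noteq> 0" using \<open>x \<notin> P\<close> ideal_zero prime_ideal[OF P] by blast
    then have "1 / x \<in> localize D P"
      using \<open>x \<notin> P\<close> xD one_closed unfolding localize_def by blast
    then obtain s where s: "s \<in> D" "s \<notin> Q" "s * (1 / x) \<in> D"
      using sub mem_localize_iff[OF prime_ideal[OF Q]] by blast
    then have "s * (1 / x) * x \<in> Q" using ideal_mult prime_ideal[OF Q] x by blast
    then show False using s \<open>x \<noteq> 0\<close> by simp
  qed
qed

lemma localize_inject:
  "primeideal P (ring_on D) \<Longrightarrow> primeideal Q (ring_on D) \<Longrightarrow> localize D P = localize D Q \<Longrightarrow> P = Q"
  using localize_subset_imp by blast

text \<open>
  The conductor of an element of all the localizations lies in no maximal \<open>t\<close>-ideal.
\<close>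

lemma Inter_localize_t_Max: "(\<Inter>M\<in>t_Max D. localize D M) = D"
proof
  have prime: "M \<in> t_Max D \<Longrightarrow> primeideal M (ring_on D)" for M
    by (simp add: t_Max_t_prime t_prime_prime)
  show "D \<subseteq> (\<Inter>M\<in>t_Max D. localize D M)" using subset_localize prime by blast
  show "(\<Inter>M\<in>t_Max D. localize D M) \<subseteq> D"
  proof
    fix x assume "x \<in> (\<Inter>M\<in>t_Max D. localize D M)"
    then have "\<not> conductor D x \<subseteq> M" if "M \<in> t_Max D" for M
      using mem_localize_iff_conductor prime prime_ideal that by blast
    then have "1 \<in> conductor D x" using exists_t_Max[OF t_ideal_conductor] by blast
    then show "x \<in> D" by (simp add: conductor_def)
  qed
qed

text \<open>
  The \<open>t#\<close>-property only has to be tested by leaving out one maximal \<open>t\<close>-ideal at a time.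
\<close>

lemma t_sharp_domain_iff:
  "t_sharp_domain D \<longleftrightarrow> (\<forall>M\<in>t_Max D. \<not> (\<Inter>N\<in>t_Max D - {M}. localize D N) \<subseteq> localize D M)"
proof
  assume sharp: "t_sharp_domain D"
  show "\<forall>M\<in>t_Max D. \<not> (\<Inter>N\<in>t_Max D - {M}. localize D N) \<subseteq> localize D M"
  proof (intro ballI notI)
    fix M assume M: "M \<in> t_Max D" and sub: "(\<Inter>N\<in>t_Max D - {M}. localize D N) \<subseteq> localize D M"
    have "(\<Inter>N\<in>t_Max D. localize D N) = localize D M \<inter> (\<Inter>N\<in>t_Max D - {M}. localize D N)"
      using M by auto
    also have "\<dots> = (\<Inter>N\<in>t_Max D - {M}. localize D N)" using sub by auto
    finally have "t_Max D = t_Max D - {M}"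
      using sharp unfolding t_sharp_domain_def by (metis Diff_subset subset_refl)
    then show False using M by blast
  qed
next
  assume R: "\<forall>M\<in>t_Max D. \<not> (\<Inter>N\<in>t_Max D - {M}. localize D N) \<subseteq> localize D M"
  have *: "\<M> \<subseteq> \<N>" if M: "\<M> \<subseteq> t_Max D" "\<N> \<subseteq> t_Max D"
      and eq: "(\<Inter>M\<in>\<M>. localize D M) = (\<Inter>M\<in>\<N>. localize D M)" for \<M> \<N>
  proof (rule subsetI, rule ccontr)
    fix M assume "M \<in> \<M>" "M \<notin> \<N>"
    then have "(\<Inter>N\<in>t_Max D - {M}. localize D N) \<subseteq> (\<Inter>M\<in>\<N>. localize D M)"
      using M by (intro INF_superset_mono) auto
    also have "\<dots> \<subseteq> localize D M" using \<open>M \<in> \<M>\<close> unfolding eq[symmetric] by auto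
    finally show False using R M \<open>M \<in> \<M>\<close> by blast
  qed
  show "t_sharp_domain D"
    unfolding t_sharp_domain_def
  proof (intro allI impI notI)
    fix \<M> \<N>
    assume "\<M> \<subseteq> t_Max D \<and> \<N> \<subseteq> t_Max D \<and> \<M> \<noteq> \<N>"
      and "(\<Inter>M\<in>\<M>. localize D M) = (\<Inter>M\<in>\<N>. localize D M)"
    then show False using *[of \<M> \<N>] *[of \<N> \<M>] by simp
  qed
qed

end

section \<open>Primes whose localization is a valuation domain\<close>

lemma valuation_domain_overring:
  "valuation_domain V \<Longrightarrow> V \<subseteq> W \<Longrightarrow> subring W (ring_of_type_algebra :: 'k::field ring) \<Longrightarrow>
    valuation_domain W"
  unfolding valuation_domain_def by blast

lemma valuation_domain_divisor:
  assumes V: "valuation_domain V" and "finite F" "\<not> F \<subseteq> {0}"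
  shows "\<exists>a\<in>F. a \<noteq> 0 \<and> (\<forall>y\<in>F. y / a \<in> V)"
  using assms(2,3)
proof (induction F rule: finite_induct)
  case (insert x F)
  have one: "1 \<in> V" and mult: "\<And>x y. x \<in> V \<Longrightarrow> y \<in> V \<Longrightarrow> x * y \<in> V"
    and minus: "\<And>x. x \<in> V \<Longrightarrow> - x \<in> V" and add: "\<And>x y. x \<in> V \<Longrightarrow> y \<in> V \<Longrightarrow> x + y \<in> V"
    and total: "\<And>x. x \<noteq> 0 \<Longrightarrow> x \<in> V \<or> inverse x \<in> V"
    using V by (auto simp: valuation_domain_def subring_iff)
  have zero: "0 \<in> V" using add[OF one minus[OF one]] by simp
  show ?case
  proof (cases "F \<subseteq> {0}")
    case True
    then have "x \<noteq> 0" using insert.prems by auto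
    then show ?thesis using True one zero by (intro bexI[of _ x]) auto
  next
    case False
    then obtain a where a: "a \<in> F" "a \<noteq> 0" "\<forall>y\<in>F. y / a \<in> V" using insert by blast
    show ?thesis
    proof (cases "x / a \<in> V")
      case True
      then show ?thesis using a by (intro bexI[of _ a]) auto
    next
      case xa: False
      then have "x \<noteq> 0" using zero by auto
      then have ax: "a / x \<in> V" using total[of "x / a"] xa a by (auto simp: field_simps)
      have "y / x \<in> V" if "y \<in> F" for y
        using mult[OF bspec[OF a(3) that] ax] \<open>x \<noteq> 0\<close> a(2) by simp
      then show ?thesis using \<open>x \<noteq> 0\<close> one by (intro bexI[of _ x]) auto
    qed
  qed
qed simp

context quotient_field_domain begin

text \<open>
  At a prime whose localization is a valuation domain, a finitely generated fractional ideal is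
  generated locally by one of its generators \<open>a\<close>. Clearing denominators in the quotients \<open>y / a\<close>
  produces an element \<open>b\<close> of \<open>(D : F)\<close> for which \<open>ab\<close> is a unit of the localization.
\<close>

lemma exists_local_inverse:
  assumes P: "primeideal P (ring_on D)" "valuation_domain (localize D P)"
    and F: "finite F" "\<not> F \<subseteq> {0}"
  shows "\<exists>a\<in>F. \<exists>b\<in>colon D F. a * b \<in> D \<and> a * b \<notin> P"
proof -
  obtain a where a: "a \<in> F" "a \<noteq> 0" "\<forall>y\<in>F. y / a \<in> localize D P"
    using valuation_domain_divisor[OF P(2) F] by blast
  obtain s where s: "s \<in> D" "s \<notin> P" "\<forall>x\<in>(\<lambda>y. y / a) ` F. s * x \<in> D"
    using localize_common_denominator[OF P(1), of "(\<lambda>y. y / a) ` F"] F a by blast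
  have "s / a \<in> colon D F" using s by (auto simp: colon_def)
  then show ?thesis using a s by (intro bexI[of _ a] bexI[of _ "s / a"]) auto
qed

text \<open>
  With \<open>a \<in> F\<close> and \<open>b \<in> (D : F)\<close> from \<open>exists_local_inverse\<close>, \<open>x \<in> F\<^sub>v\<close> satisfies \<open>xb \<in> D\<close>, so
  \<open>(ab)x = (xb)a\<close> lies in \<open>P\<close> while \<open>ab\<close> does not.
\<close>

lemma t_prime_if_valuation_domain:
  assumes P: "primeideal P (ring_on D)" "P \<noteq> {0}" "valuation_domain (localize D P)"
  shows "t_prime D P"
proof -
  note PI = prime_ideal[OF P(1)]
  have "x \<in> P" if F: "finite F" "F \<subseteq> P" "\<not> F \<subseteq> {0}" and x: "x \<in> v_closure D F" for F x
  proof -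
    obtain a b where ab: "a \<in> F" "b \<in> colon D F" "a * b \<in> D" "a * b \<notin> P"
      using exists_local_inverse[OF P(1,3) F(1,3)] by blast
    have "F \<subseteq> D" using F(2) ideal_subset[OF PI] by blast
    then have xD: "x \<in> D" using x v_closure_subset_domain by blast
    have "x * b \<in> D" using x ab(2) unfolding v_closure_def colon_def[of D "colon D F"] by blast
    then have "(x * b) * a \<in> P" using ideal_mult[OF PI] ab(1) F(2) by blast
    then have "(a * b) * x \<in> P" by (simp add: algebra_simps)
    then show ?thesis using prime_mult[OF P(1) ab(3) xD] ab(4) by blast
  qed
  then have "t_ideal D P" using PI P(2) unfolding t_ideal_iff by blast
  then show ?thesis using P(1) by (simp add: t_prime_def)
qed

lemma valuation_domain_localize_subset:
  assumes "primeideal P (ring_on D)" "primeideal Q (ring_on D)" "Q \<subseteq> P"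
    and "valuation_domain (localize D P)"
  shows "valuation_domain (localize D Q)"
  using assms localize_antimono[of Q P] overring_localize[of Q]
  by (auto simp: overring_def intro: valuation_domain_overring)

lemma primes_below_valuation_prime_comparable:
  assumes P: "primeideal P (ring_on D)" "valuation_domain (localize D P)"
    and Q: "primeideal Q (ring_on D)" "primeideal Q' (ring_on D)" "Q \<subseteq> P" "Q' \<subseteq> P"
  shows "Q \<subseteq> Q' \<or> Q' \<subseteq> Q"
proof -
  have *: False if ab: "a \<in> A" "a \<notin> B" "b \<in> B" "a / b \<in> localize D P"
      and A: "primeideal A (ring_on D)" and B: "primeideal B (ring_on D)" "B \<subseteq> P" "b \<noteq> 0"
    for a b A B
  proof -
    obtain s where s: "s \<in> D" "s \<notin> P" "s * (a / b) \<in> D"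
      using ab mem_localize_iff[OF prime_ideal[OF P(1)]] by blast
    have "s * (a / b) * b \<in> B" using ideal_mult[OF prime_ideal[OF B(1)] s(3) ab(3)] .
    then have "s * a \<in> B" using \<open>b \<noteq> 0\<close> by simp
    moreover have "a \<in> D" using ideal_subset[OF prime_ideal[OF A] ab(1)] .
    ultimately show False using prime_mult[OF B(1) s(1)] s(2) ab(2) B(2) by blast
  qed
  show ?thesis
  proof (rule ccontr)
    assume "\<not> ?thesis"
    then obtain a b where ab: "a \<in> Q" "a \<notin> Q'" "b \<in> Q'" "b \<notin> Q" by blast
    then have "a \<noteq> 0" "b \<noteq> 0" using ideal_zero prime_ideal Q by blast+
    then have "a / b \<in> localize D P \<or> b / a \<in> localize D P"
      using P(2) unfolding valuation_domain_def
      by (metis divide_eq_0_iff inverse_divide)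
    then show False
      using *[of a Q Q' b] *[of b Q' Q a] ab Q \<open>a \<noteq> 0\<close> \<open>b \<noteq> 0\<close> by blast
  qed
qed

section \<open>Primes of overrings\<close>

lemma contraction_prime:
  assumes T: "overring D T" and N: "primeideal N (ring_on T)"
  shows "primeideal (N \<inter> D) (ring_on D)"
proof -
  interpret T: quotient_field_domain T using overring_domain[OF T] .
  have sub: "D \<subseteq> T" using T by (simp add: overring_def)
  note NI = T.prime_ideal[OF N]
  show ?thesis
    unfolding primeideal_iff ideal_iff
  proof (intro conjI ballI impI)
    show "a \<in> N \<inter> D \<or> b \<in> N \<inter> D" if "a \<in> D" "b \<in> D" "a * b \<in> N \<inter> D" for a b
      using T.prime_mult[OF N, of a b] that sub by blast
  qed (use T.ideal_zero[OF NI] T.ideal_add[OF NI] T.ideal_mult[OF NI] T.prime_one[OF N] sub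
       in \<open>auto dest: subsetD\<close>)
qed

lemma contraction_nonzero:
  assumes T: "overring D T" and N: "ideal N (ring_on T)" "N \<noteq> {0}"
  shows "N \<inter> D \<noteq> {0}"
proof -
  interpret T: quotient_field_domain T using overring_domain[OF T] .
  obtain x where x: "x \<in> N" "x \<noteq> 0" using N T.ideal_zero by blast
  obtain s where s: "s \<in> D" "s \<noteq> 0" "s * x \<in> D" using exists_denominator by blast
  have "s * x \<in> N" using T.ideal_mult[OF N(1)] s T x by (auto simp: overring_def)
  then have "s * x \<in> N \<inter> D" "s * x \<noteq> 0" using s x by simp_all
  then show ?thesis by blast
qed

text \<open>
  The local ring \<open>T\<^sub>N\<close> dominates the localization of \<open>D\<close> at \<open>N \<inter> D\<close>, and a valuation domain is
  maximal for domination.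
\<close>

lemma localize_overring_eq:
  assumes T: "overring D T" and N: "primeideal N (ring_on T)"
    and V: "valuation_domain (localize D (N \<inter> D))"
  shows "localize T N = localize D (N \<inter> D)"
proof
  interpret T: quotient_field_domain T using overring_domain[OF T] .
  have sub: "D \<subseteq> T" using T by (simp add: overring_def)
  note P = contraction_prime[OF T N]
  show "localize D (N \<inter> D) \<subseteq> localize T N"
    using sub unfolding localize_def by blast
  show "localize T N \<subseteq> localize D (N \<inter> D)"
  proof (rule subsetI, rule ccontr)
    fix x assume x: "x \<in> localize T N" "x \<notin> localize D (N \<inter> D)"
    then have "x \<noteq> 0" using subsetD[OF subset_localize[OF P] zero_closed] by blast
    then have "inverse x \<in> localize D (N \<inter> D)" using V x(2) by (auto simp: valuation_domain_def)
    then obtain a s where as: "a \<in> D" "s \<in> D" "s \<notin> N" "inverse x = a / s"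
      unfolding localize_def by blast
    have "s \<noteq> 0" using as T.ideal_zero T.prime_ideal N by blast
    then have s: "s = a * x" using as \<open>x \<noteq> 0\<close> by (simp add: field_simps)
    have "x = s / a" using s \<open>s \<noteq> 0\<close> by auto
    then have "a \<in> N" using x(2) as unfolding localize_def by blast
    obtain r where r: "r \<in> T" "r \<notin> N" "r * x \<in> T"
      using x(1) T.mem_localize_iff[OF T.prime_ideal[OF N]] by blast
    have "(r * x) * a \<in> N" using T.ideal_mult[OF T.prime_ideal[OF N] r(3) \<open>a \<in> N\<close>] .
    then have "r * s \<in> N" by (simp add: s algebra_simps)
    then show False using T.prime_mult[OF N r(1)] r(2) as sub by blast
  qed
qed

text \<open>The prime in question is \<open>PD\<^sub>P \<inter> T\<close>.\<close>

lemma exists_prime_over: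
  assumes T: "overring D T" and P: "primeideal P (ring_on D)" and TP: "T \<subseteq> localize D P"
  shows "\<exists>Q. primeideal Q (ring_on T) \<and> Q \<inter> D = P \<and> localize T Q = localize D P"
proof (intro exI conjI)
  interpret T: quotient_field_domain T using overring_domain[OF T] .
  have sub: "D \<subseteq> T" using T by (simp add: overring_def)
  note PI = prime_ideal[OF P]
  have den: "\<exists>s\<in>D. s \<notin> P \<and> s * x \<in> D" if "x \<in> T" for x
    using that TP mem_localize_iff[OF PI] by blast
  have prod: "s * t \<in> D \<and> s * t \<notin> P" if "s \<in> D" "s \<notin> P" "t \<in> D" "t \<notin> P" for s t
    using that prime_mult[OF P] by auto
  define Q where "Q = {x \<in> T. \<exists>s\<in>D. s \<notin> P \<and> s * x \<in> P}"
  have memQ: "x \<in> Q" if "x \<in> T" "s \<in> D" "s \<notin> P" "s * x \<in> P" for x s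
    using that unfolding Q_def by blast
  have QD: "Q \<inter> D = P"
  proof
    show "Q \<inter> D \<subseteq> P" using prime_mult[OF P] by (auto simp: Q_def)
    show "P \<subseteq> Q \<inter> D"
      using sub ideal_subset[OF PI] prime_one[OF P] by (auto simp: Q_def intro!: bexI[of _ 1])
  qed
  then show "Q \<inter> D = P" .
  show prime: "primeideal Q (ring_on T)"
    unfolding T.primeideal_iff T.ideal_iff
  proof (intro conjI ballI impI)
    show "Q \<subseteq> T" by (auto simp: Q_def)
    show "0 \<in> Q" using prime_one[OF P] ideal_zero[OF PI] by (auto simp: Q_def intro!: bexI[of _ 1])
    show "1 \<notin> Q" by (auto simp: Q_def)
  next
    fix x y assume "x \<in> Q" "y \<in> Q"
    then obtain s t where st: "x \<in> T" "s \<in> D" "s \<notin> P" "s * x \<in> P" "y \<in> T" "t \<in> D" "t \<notin> P" "t * y \<in> P"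
      unfolding Q_def by blast
    have "t * (s * x) + s * (t * y) \<in> P"
      by (intro ideal_add[OF PI] ideal_mult[OF PI] st)
    then have "(s * t) * (x + y) \<in> P" by (simp add: algebra_simps)
    then show "x + y \<in> Q" using memQ[of "x + y" "s * t"] prod[of s t] st by simp
  next
    fix r x assume r: "r \<in> T" and "x \<in> Q"
    then obtain s t where st: "x \<in> T" "s \<in> D" "s \<notin> P" "s * x \<in> P" "t \<in> D" "t \<notin> P" "t * r \<in> D"
      using den[OF r] unfolding Q_def by blast
    have "(t * r) * (s * x) \<in> P" by (intro ideal_mult[OF PI] st)
    then have "(s * t) * (r * x) \<in> P" by (simp add: algebra_simps)
    then show "r * x \<in> Q" using memQ[of "r * x" "s * t"] prod[of s t] st r by simp
  next
    fix a b assume a: "a \<in> T" and b: "b \<in> T" and "a * b \<in> Q"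
    then obtain s where s: "s \<in> D" "s \<notin> P" "s * (a * b) \<in> P" unfolding Q_def by blast
    obtain t where t: "t \<in> D" "t \<notin> P" "t * a \<in> D" using den[OF a] by blast
    obtain u where u: "u \<in> D" "u \<notin> P" "u * b \<in> D" using den[OF b] by blast
    have "(t * u) * (s * (a * b)) \<in> P" using ideal_mult[OF PI _ s(3)] t u by simp
    then have "s * ((t * a) * (u * b)) \<in> P" by (simp add: algebra_simps)
    then have "(t * a) * (u * b) \<in> P" using prime_mult[OF P s(1)] s(2) t(3) u(3) mult_closed by blast
    then have "t * a \<in> P \<or> u * b \<in> P" using prime_mult[OF P t(3) u(3)] by blast
    then show "a \<in> Q \<or> b \<in> Q" using memQ[OF a t(1,2)] memQ[OF b u(1,2)] by blast
  qed
  show "localize T Q = localize D P"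
  proof
    show "localize D P \<subseteq> localize T Q" using sub QD unfolding localize_def by blast
    show "localize T Q \<subseteq> localize D P"
    proof
      fix x assume "x \<in> localize T Q"
      then obtain q where q: "q \<in> T" "q \<notin> Q" "q * x \<in> T"
        using T.mem_localize_iff[OF T.prime_ideal[OF prime]] by blast
      obtain t where t: "t \<in> D" "t \<notin> P" "t * q \<in> D" using den[OF q(1)] by blast
      obtain u where u: "u \<in> D" "u \<notin> P" "u * (q * x) \<in> D" using den[OF q(3)] by blast
      have "t * q \<notin> P" using q t unfolding Q_def by blast
      then have "u * (t * q) \<in> D" "u * (t * q) \<notin> P" using prod u t by auto
      moreover have "(u * (t * q)) * x = t * (u * (q * x))" by (simp add: algebra_simps)
      ultimately show "x \<in> localize D P"
        using t u mem_localize_iff[OF PI] by (metis mult_closed)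
    qed
  qed
qed

section \<open>\<open>t\<close>-linked overrings\<close>

lemma t_linked_overring_iff:
  "t_linked_overring D T \<longleftrightarrow> overring D T \<and>
     (\<forall>B. finite B \<and> B \<subseteq> D \<and> \<not> B \<subseteq> {0} \<and> colon D B = D \<longrightarrow> colon T B = T)"
proof (cases "overring D T")
  case T: True
  interpret T: quotient_field_domain T using overring_domain[OF T] .
  have sub: "D \<subseteq> T" using T by (simp add: overring_def)
  have colon: "colon T (span_over T (span_over D B)) = colon T B" for B
    using colon_span_over[OF T.quotient_field_domain_axioms sub, of B]
      T.colon_span_over[OF T.quotient_field_domain_axioms subset_refl] by simp
  have colon': "colon D (span_over D B) = colon D B" for B
    using colon_span_over[OF quotient_field_domain_axioms subset_refl] .
  show ?thesis
  proof
    assume L: "t_linked_overring D T"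
    have "colon T B = T" if B: "finite B" "B \<subseteq> D" "\<not> B \<subseteq> {0}" "colon D B = D" for B
      using L B ideal_span_over[OF B(2)] span_over_eq_zero_iff[of B] colon colon'
      unfolding t_linked_overring_def fin_gen_def by metis
    then show "overring D T \<and>
        (\<forall>B. finite B \<and> B \<subseteq> D \<and> \<not> B \<subseteq> {0} \<and> colon D B = D \<longrightarrow> colon T B = T)"
      using T by blast
  next
    assume R: "overring D T \<and>
        (\<forall>B. finite B \<and> B \<subseteq> D \<and> \<not> B \<subseteq> {0} \<and> colon D B = D \<longrightarrow> colon T B = T)"
    show "t_linked_overring D T"
      unfolding t_linked_overring_def
    proof (intro conjI allI impI T)
      fix I assume I: "ideal I (ring_on D) \<and> I \<noteq> {0} \<and> fin_gen D I \<and> colon D I = D"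
      then obtain B where B: "finite B" "I = span_over D B" unfolding fin_gen_def by blast
      then have "B \<subseteq> D" using subset_span_over[of B] ideal_subset I by blast
      then have "colon T B = T"
        using R B I span_over_eq_zero_iff[of B] colon' by auto
      then show "colon T (span_over T I) = T" using B colon by simp
    qed
  qed
qed (simp add: t_linked_overring_def)

lemma overring_Inter_localize:
  assumes "\<And>P. P \<in> \<P> \<Longrightarrow> primeideal P (ring_on D)"
  shows "overring D (\<Inter>P\<in>\<P>. localize D P)"
  using overring_localize[OF assms] unfolding overring_def subring_iff by blast

text \<open>
  If \<open>yB\<close> is contained in \<open>D\<^sub>P\<close>, a common denominator \<open>s\<close> puts \<open>sy\<close> into \<open>(D : B) = D\<close>, so \<open>y \<in>
  D\<^sub>P\<close>.
\<close>

lemma t_linked_Inter_localize: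
  assumes P: "\<And>P. P \<in> \<P> \<Longrightarrow> primeideal P (ring_on D)"
  shows "t_linked_overring D (\<Inter>P\<in>\<P>. localize D P)"
proof -
  let ?T = "\<Inter>P\<in>\<P>. localize D P"
  have over: "overring D ?T" using overring_Inter_localize P by blast
  then interpret T: quotient_field_domain ?T by (rule overring_domain)
  have "colon ?T B = ?T" if B: "finite B" "B \<subseteq> D" "colon D B = D" for B
  proof
    show "?T \<subseteq> colon ?T B"
      unfolding colon_def
    proof (intro subsetI CollectI ballI)
      fix x y assume "x \<in> ?T" "y \<in> B"
      moreover have "B \<subseteq> ?T" using B over unfolding overring_def by (meson subset_trans)
      ultimately show "x * y \<in> ?T" using T.mult_closed by (meson subsetD)
    qed
    show "colon ?T B \<subseteq> ?T"
    proof (intro subsetI INT_I)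
      fix y P assume y: "y \<in> colon ?T B" and PP: "P \<in> \<P>"
      have "finite ((*) y ` B)" "(*) y ` B \<subseteq> localize D P"
        using B y PP by (auto simp: colon_def)
      then obtain s where s: "s \<in> D" "s \<notin> P" "\<forall>x\<in>(*) y ` B. s * x \<in> D"
        using localize_common_denominator[OF P[OF PP]] by blast
      then have "s * y \<in> colon D B" by (auto simp: colon_def mult.assoc)
      then show "y \<in> localize D P"
        using s B mem_localize_iff[OF prime_ideal[OF P[OF PP]]] by auto
    qed
  qed
  then show ?thesis using over unfolding t_linked_overring_iff by blast
qed

end

section \<open>The families \<open>\<Phi>(\<Lambda>)\<close>\<close>

lemma incomparable_t_primesI:
  assumes "\<And>P. P \<in> \<Lambda> \<Longrightarrow> t_prime D P"
    and "\<And>P Q. P \<in> \<Lambda> \<Longrightarrow> Q \<in> \<Lambda> \<Longrightarrow> P \<subseteq> Q \<Longrightarrow> P = Q"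
  shows "incomparable_t_primes D \<Lambda>"
  using assms unfolding incomparable_t_primes_def pairwise_def by blast

lemma incomparable_t_primesD:
  "incomparable_t_primes D \<Lambda> \<Longrightarrow> P \<in> \<Lambda> \<Longrightarrow> t_prime D P"
  by (simp add: incomparable_t_primes_def)

lemma incomparable_t_primes_eq:
  "incomparable_t_primes D \<Lambda> \<Longrightarrow> P \<in> \<Lambda> \<Longrightarrow> Q \<in> \<Lambda> \<Longrightarrow> P \<subseteq> Q \<Longrightarrow> P = Q"
  unfolding incomparable_t_primes_def pairwise_def by blast

lemma incomparable_t_primes_subset:
  "incomparable_t_primes D \<Lambda> \<Longrightarrow> \<Lambda>' \<subseteq> \<Lambda> \<Longrightarrow> incomparable_t_primes D \<Lambda>'"
  unfolding incomparable_t_primes_def pairwise_def by blast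

context quotient_field_domain begin

lemma incomparable_t_Max:
  "\<Lambda> \<subseteq> t_Max D \<Longrightarrow> incomparable_t_primes D \<Lambda>"
  using t_Max_t_prime t_Max_subset_imp_eq
  unfolding incomparable_t_primes_def pairwise_def by blast

text \<open>
  For an element \<open>x\<close> of the intersection, the conductor of \<open>x\<close> is a member of \<open>\<Phi>(\<Lambda>)\<close>.
\<close>

lemma ring_of_fractions_Phi:
  assumes P: "\<And>P. P \<in> \<Lambda> \<Longrightarrow> primeideal P (ring_on D)"
  shows "ring_of_fractions D (Phi D \<Lambda>) = (\<Inter>P\<in>\<Lambda>. localize D P)"
proof
  show "ring_of_fractions D (Phi D \<Lambda>) \<subseteq> (\<Inter>P\<in>\<Lambda>. localize D P)"
  proof (intro subsetI INT_I)
    fix x P assume x: "x \<in> ring_of_fractions D (Phi D \<Lambda>)" and "P \<in> \<Lambda>"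
    then obtain I where I: "t_ideal D I" "\<not> I \<subseteq> P" "\<forall>y\<in>I. x * y \<in> D"
      unfolding ring_of_fractions_def Phi_def by blast
    then obtain s where "s \<in> I" "s \<notin> P" by blast
    then show "x \<in> localize D P"
      using I ideal_subset[OF t_ideal_ideal[OF I(1)]]
      by (auto simp: mem_localize_iff[OF prime_ideal[OF P[OF \<open>P \<in> \<Lambda>\<close>]]] mult.commute
               intro!: bexI[of _ s])
  qed
  show "(\<Inter>P\<in>\<Lambda>. localize D P) \<subseteq> ring_of_fractions D (Phi D \<Lambda>)"
  proof
    fix x assume x: "x \<in> (\<Inter>P\<in>\<Lambda>. localize D P)"
    have "conductor D x \<in> Phi D \<Lambda>"
      using x t_ideal_conductor mem_localize_iff_conductor[OF prime_ideal[OF P]]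
      by (auto simp: Phi_def)
    moreover have "\<forall>y\<in>conductor D x. x * y \<in> D" by (auto simp: conductor_def mult.commute)
    ultimately show "x \<in> ring_of_fractions D (Phi D \<Lambda>)" unfolding ring_of_fractions_def by blast
  qed
qed

text \<open>
  A \<open>t\<close>-prime that contains a nonzero finite set contains its divisorial closure. So
  \<open>v\<close>-finiteness of \<open>\<Phi>(\<Lambda>)\<close> means that a \<open>t\<close>-ideal which escapes from \<open>\<Lambda>\<close> has a finite subset
  which already does.
\<close>

lemma v_finite_Phi_iff:
  assumes P: "\<And>P. P \<in> \<Lambda> \<Longrightarrow> t_prime D P"
  shows "v_finite D (Phi D \<Lambda>) \<longleftrightarrow>
    (\<forall>I\<in>Phi D \<Lambda>. \<exists>F. finite F \<and> F \<subseteq> I \<and> (\<forall>P\<in>\<Lambda>. \<not> F \<subseteq> P))"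
proof
  assume v: "v_finite D (Phi D \<Lambda>)"
  show "\<forall>I\<in>Phi D \<Lambda>. \<exists>F. finite F \<and> F \<subseteq> I \<and> (\<forall>P\<in>\<Lambda>. \<not> F \<subseteq> P)"
  proof
    fix I assume "I \<in> Phi D \<Lambda>"
    then obtain J where J: "J \<noteq> {0}" "fin_gen D J" "J \<subseteq> I" "v_closure D J \<in> Phi D \<Lambda>"
      using v unfolding v_finite_def by blast
    then obtain F where F: "finite F" "J = span_over D F" unfolding fin_gen_def by blast
    then have "\<not> F \<subseteq> {0}" "F \<subseteq> I"
      using J span_over_eq_zero_iff[of F] subset_span_over[of F] by auto
    moreover have "\<not> F \<subseteq> P" if "P \<in> \<Lambda>" for P
      using t_ideal_v_closure[OF t_prime_t_ideal[OF P[OF that]] F(1)] J(4) that F(2)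
        calculation(1) v_closure_span_over[of F] by (auto simp: Phi_def)
    ultimately show "\<exists>F. finite F \<and> F \<subseteq> I \<and> (\<forall>P\<in>\<Lambda>. \<not> F \<subseteq> P)" using F(1) by blast
  qed
next
  assume R: "\<forall>I\<in>Phi D \<Lambda>. \<exists>F. finite F \<and> F \<subseteq> I \<and> (\<forall>P\<in>\<Lambda>. \<not> F \<subseteq> P)"
  show "v_finite D (Phi D \<Lambda>)"
    unfolding v_finite_def
  proof
    fix I assume I: "I \<in> Phi D \<Lambda>"
    then have tI: "t_ideal D I" by (simp add: Phi_def)
    obtain F where F: "finite F" "F \<subseteq> I" "\<forall>P\<in>\<Lambda>. \<not> F \<subseteq> P" using bspec[OF R I] by blast
    obtain a where a: "a \<in> I" "a \<noteq> 0" using t_ideal_nonzero[OF tI] by blast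
    let ?G = "insert a F"
    have G: "finite ?G" "?G \<subseteq> I" "\<not> ?G \<subseteq> {0}" using F a by auto
    have GD: "?G \<subseteq> D" using G(2) ideal_subset[OF t_ideal_ideal[OF tI]] by blast
    have "\<not> v_closure D ?G \<subseteq> P" if "P \<in> \<Lambda>" for P
      using F(3) that subset_v_closure[of ?G] by blast
    then have "v_closure D (span_over D ?G) \<in> Phi D \<Lambda>"
      using t_ideal_v_closure_finite[OF G(1) GD G(3)] by (simp add: Phi_def v_closure_span_over)
    moreover have "ideal (span_over D ?G) (ring_on D)" by (rule ideal_span_over[OF GD])
    moreover have "span_over D ?G \<noteq> {0}" using span_over_eq_zero_iff[of ?G] G(3) by blast
    moreover have "fin_gen D (span_over D ?G)" using G(1) unfolding fin_gen_def by blast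
    moreover have "span_over D ?G \<subseteq> I"
      using span_over_subset_iff[OF t_ideal_ideal[OF tI]] G(2) by blast
    ultimately show "\<exists>J. ideal J (ring_on D) \<and> J \<noteq> {0} \<and> fin_gen D J \<and> J \<subseteq> I \<and>
        v_closure D J \<in> Phi D \<Lambda>" by blast
  qed
qed

lemma v_finite_PhiD:
  assumes v: "v_finite D (Phi D \<Lambda>)" and \<Lambda>: "\<forall>P\<in>\<Lambda>. t_prime D P" and I: "I \<in> Phi D \<Lambda>"
  shows "\<exists>F. finite F \<and> F \<subseteq> I \<and> (\<forall>P\<in>\<Lambda>. \<not> F \<subseteq> P)"
proof -
  have "\<forall>I\<in>Phi D \<Lambda>. \<exists>F. finite F \<and> F \<subseteq> I \<and> (\<forall>P\<in>\<Lambda>. \<not> F \<subseteq> P)"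
    using v \<Lambda> v_finite_Phi_iff[of \<Lambda>] by simp
  then show ?thesis using I by (rule bspec)
qed

text \<open>
  Zorn's lemma enlarges \<open>I\<close> to a \<open>t\<close>-ideal \<open>Q\<close> that is maximal subject to having no finite subset
  that escapes from \<open>\<Lambda>\<close>. If \<open>Q\<close> contains \<open>ab\<close> but neither factor, then \<open>(Q : a)\<close> contains a
  finite set \<open>F\<^sub>1\<close> that escapes, \<open>(Q : F\<^sub>1)\<close> contains \<open>a\<close> and so a finite set \<open>F\<^sub>2\<close> that escapes,
  and the products of \<open>F\<^sub>1\<close> and \<open>F\<^sub>2\<close> form a finite subset of \<open>Q\<close> that escapes.
\<close>

lemma exists_t_prime_without_finite_escape:
  assumes P: "\<And>P. P \<in> \<Lambda> \<Longrightarrow> primeideal P (ring_on D)"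
    and I: "t_ideal D I" and fin: "\<And>F. finite F \<Longrightarrow> F \<subseteq> I \<Longrightarrow> \<exists>P\<in>\<Lambda>. F \<subseteq> P"
  shows "\<exists>Q. t_prime D Q \<and> I \<subseteq> Q \<and> (\<forall>F. finite F \<longrightarrow> F \<subseteq> Q \<longrightarrow> (\<exists>P\<in>\<Lambda>. F \<subseteq> P))"
proof -
  define \<A> where "\<A> = {J. t_ideal D J \<and> I \<subseteq> J \<and> (\<forall>F. finite F \<longrightarrow> F \<subseteq> J \<longrightarrow> (\<exists>P\<in>\<Lambda>. F \<subseteq> P))}"
  have "\<exists>Q\<in>\<A>. \<forall>J\<in>\<A>. Q \<subseteq> J \<longrightarrow> J = Q"
  proof (rule subset_Zorn_nonempty)
    show "\<A> \<noteq> {}" using I fin by (auto simp: \<A>_def)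
    fix \<C> assume ne: "\<C> \<noteq> {}" and chain: "subset.chain \<A> \<C>"
    have sub: "\<C> \<subseteq> \<A>" using chain by (simp add: subset.chain_def)
    have "t_ideal D (\<Union>\<C>)"
      by (rule t_ideal_Union_chain[OF chain _ ne]) (simp add: \<A>_def)
    moreover have "I \<subseteq> \<Union>\<C>" using sub ne by (auto simp: \<A>_def)
    moreover have "\<exists>P\<in>\<Lambda>. F \<subseteq> P" if F: "finite F" "F \<subseteq> \<Union>\<C>" for F
    proof -
      obtain J where "J \<in> \<C>" "F \<subseteq> J" using finite_subset_Union_chain[OF F ne chain] .
      then show ?thesis using sub F(1) by (auto simp: \<A>_def)
    qed
    ultimately show "\<Union>\<C> \<in> \<A>" by (simp add: \<A>_def)
  qed
  then obtain Q where QA: "Q \<in> \<A>" and max: "\<And>J. J \<in> \<A> \<Longrightarrow> Q \<subseteq> J \<Longrightarrow> J = Q" by blast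
  have Q: "t_ideal D Q" "I \<subseteq> Q" and Qfin: "\<And>F. finite F \<Longrightarrow> F \<subseteq> Q \<Longrightarrow> \<exists>P\<in>\<Lambda>. F \<subseteq> P"
    using QA by (auto simp: \<A>_def)
  note QI = t_ideal_ideal[OF Q(1)]
  have escape: "\<exists>F. finite F \<and> F \<subseteq> {r \<in> D. \<forall>s\<in>S. s * r \<in> Q} \<and> (\<forall>P\<in>\<Lambda>. \<not> F \<subseteq> P)"
    if S: "S \<subseteq> D" and c: "c \<in> D" "c \<notin> Q" "\<forall>s\<in>S. s * c \<in> Q" for S c
  proof (rule ccontr)
    let ?J = "{r \<in> D. \<forall>s\<in>S. s * r \<in> Q}"
    assume no: "\<not> ?thesis"
    have QJ: "Q \<subseteq> ?J" using ideal_mult[OF QI] ideal_subset[OF QI] S by blast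
    have "I \<subseteq> ?J" using Q(2) QJ by (rule subset_trans)
    moreover have "\<forall>F. finite F \<longrightarrow> F \<subseteq> ?J \<longrightarrow> (\<exists>P\<in>\<Lambda>. F \<subseteq> P)" using no by meson
    ultimately have "?J \<in> \<A>"
      using t_ideal_transporter[OF Q(1) S] unfolding \<A>_def mem_Collect_eq by (intro conjI)
    then have "?J = Q" using max QJ by blast
    then show False using c by blast
  qed
  have "b \<in> Q" if ab: "a \<in> D" "b \<in> D" "a * b \<in> Q" "a \<notin> Q" for a b
  proof (rule ccontr)
    assume b: "b \<notin> Q"
    obtain F where F: "finite F" "F \<subseteq> {r \<in> D. \<forall>s\<in>{a}. s * r \<in> Q}" "\<forall>P\<in>\<Lambda>. \<not> F \<subseteq> P"
      using escape[of "{a}" b] ab b by auto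
    have Fa: "F \<subseteq> D" "\<forall>s\<in>F. s * a \<in> Q" using F(2) by (auto simp: mult.commute)
    obtain G where G: "finite G" "G \<subseteq> {r \<in> D. \<forall>s\<in>F. s * r \<in> Q}" "\<forall>P\<in>\<Lambda>. \<not> G \<subseteq> P"
      using escape[of F a] ab(1,4) Fa by blast
    have "finite ((\<lambda>(x, y). x * y) ` (F \<times> G))" "(\<lambda>(x, y). x * y) ` (F \<times> G) \<subseteq> Q"
      using F G by auto
    then obtain P' where P': "P' \<in> \<Lambda>" "(\<lambda>(x, y). x * y) ` (F \<times> G) \<subseteq> P'" using Qfin by blast
    obtain x y where "x \<in> F" "x \<notin> P'" "y \<in> G" "y \<notin> P'" using F(3) G(3) P'(1) by blast
    moreover have "x * y \<in> P'" using P'(2) calculation by auto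
    ultimately show False using prime_mult[OF P[OF P'(1)], of x y] F(2) G(2) by blast
  qed
  moreover have "1 \<notin> Q" using Qfin[of "{1}"] P prime_one by auto
  ultimately have "primeideal Q (ring_on D)" using QI unfolding primeideal_iff by blast
  then show ?thesis using Q Qfin unfolding t_prime_def by blast
qed

lemma span_over_mono: "S \<subseteq> S' \<Longrightarrow> span_over D S \<subseteq> span_over D S'"
  unfolding span_over_def by blast

lemma finite_subset_span_over:
  assumes "finite B" "B \<subseteq> span_over D S"
  shows "\<exists>S'. finite S' \<and> S' \<subseteq> S \<and> B \<subseteq> span_over D S'"
  using assms
proof (induction B rule: finite_induct)
  case (insert x B)
  then obtain S' where S': "finite S'" "S' \<subseteq> S" "B \<subseteq> span_over D S'" by blast
  obtain F where F: "finite F" "F \<subseteq> S" "x \<in> span_over D F"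
  proof -
    obtain F c where F: "finite F" "F \<subseteq> S" "\<forall>y\<in>F. c y \<in> D" "x = (\<Sum>y\<in>F. c y * y)"
      using insert.prems by (auto simp: span_over_def)
    then have "x \<in> span_over D F" unfolding span_over_def by blast
    then show ?thesis using that F by blast
  qed
  have "insert x B \<subseteq> span_over D (S' \<union> F)"
    using S' F span_over_mono[of S' "S' \<union> F"] span_over_mono[of F "S' \<union> F"] by blast
  then show ?case using S' F by (intro exI[of _ "S' \<union> F"]) auto
qed blast

end

section \<open>Pruefer \<open>v\<close>-multiplication domains\<close>

abbreviation (input) t_Max_contractions :: "'k::field set \<Rightarrow> 'k set \<Rightarrow> 'k set set" where
  "t_Max_contractions R T \<equiv> {M \<inter> R | M. M \<in> t_Max T}"

locale prufer_v_multiplication_domain = quotient_field_domain R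
  for R :: "'k::field set" +
  assumes PVMD: "PVMD R"
begin

lemma valuation_domain_t_prime:
  assumes P: "t_prime R P"
  shows "valuation_domain (localize R P)"
proof -
  obtain M where M: "M \<in> t_Max R" "P \<subseteq> M" using t_prime_subset_t_Max[OF P] by blast
  then show ?thesis
    using PVMD valuation_domain_localize_subset[of M P] t_prime_prime[OF P]
      t_prime_prime[OF t_Max_t_prime[OF M(1)]] by (auto simp: PVMD_def)
qed

lemma t_primes_below_comparable:
  assumes "t_prime R P" "t_prime R Q" "t_prime R Q'" "Q \<subseteq> P" "Q' \<subseteq> P"
  shows "Q \<subseteq> Q' \<or> Q' \<subseteq> Q"
  using assms primes_below_valuation_prime_comparable[OF _ valuation_domain_t_prime]
    t_prime_prime by blast

text \<open>
  Nonzero finitely generated ideals are \<open>t\<close>-invertible: the ideal generated by the products of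
  \<open>F\<close> and \<open>(R : F)\<close> lies in no maximal \<open>t\<close>-ideal, so finitely many of these products already have
  divisorial closure \<open>R\<close>.
\<close>

lemma finite_t_invertible:
  assumes F: "finite F" "\<not> F \<subseteq> {0}"
  shows "\<exists>G. finite G \<and> G \<subseteq> colon R F \<and> {f * g |f g. f \<in> F \<and> g \<in> G} \<subseteq> R \<and>
    \<not> {f * g |f g. f \<in> F \<and> g \<in> G} \<subseteq> {0} \<and> 1 \<in> v_closure R {f * g |f g. f \<in> F \<and> g \<in> G}"
proof -
  define S where "S = (\<lambda>(f, g). f * g) ` (F \<times> colon R F)"
  have SR: "S \<subseteq> R" by (auto simp: S_def colon_def mult.commute)
  have escape: "\<not> S \<subseteq> P" if "primeideal P (ring_on R)" "valuation_domain (localize R P)" for P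
    using exists_local_inverse[OF that F] by (force simp: S_def)
  \<comment> \<open>the zero ideal is treated as one more prime with a valuation localization: it shows that the
    products are not all zero, even if there are no maximal \<open>t\<close>-ideals\<close>
  have "primeideal {0} (ring_on R)"
    by (auto simp: primeideal_iff ideal_iff)
  moreover have "localize R {0} = UNIV"
  proof -
    have "x \<in> localize R {0}" for x
      using exists_denominator[of x] mem_localize_iff[of "{0}" x] by (auto simp: ideal_iff)
    then show ?thesis by blast
  qed
  moreover have "valuation_domain (UNIV :: 'k set)"
    by (simp add: valuation_domain_def subring_iff)
  ultimately have nonzero: "\<not> S \<subseteq> {0}" using escape[of "{0}"] by simp
  have "\<not> span_over R S \<subseteq> M" if "M \<in> t_Max R" for M
    using escape[of M] subset_span_over[of S] t_Max_t_prime[OF that] t_prime_prime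
      valuation_domain_t_prime by blast
  moreover have "span_over R S \<noteq> {0}" using nonzero span_over_eq_zero_iff by blast
  ultimately obtain B where B: "finite B" "B \<subseteq> span_over R S" "\<not> B \<subseteq> {0}" "1 \<in> v_closure R B"
    using exists_finite_v_closure_one[OF ideal_span_over[OF SR]] by blast
  obtain S' where S': "finite S'" "S' \<subseteq> S" "B \<subseteq> span_over R S'"
    using finite_subset_span_over[OF B(1,2)] by blast
  then obtain C where C: "finite C" "C \<subseteq> F \<times> colon R F" "S' = (\<lambda>(f, g). f * g) ` C"
    unfolding S_def by (metis finite_subset_image)
  define G where "G = snd ` C"
  let ?FG = "{f * g |f g. f \<in> F \<and> g \<in> G}"
  have G: "finite G" "G \<subseteq> colon R F" using C by (auto simp: G_def)
  have "S' \<subseteq> ?FG" using C by (force simp: G_def)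
  then have BFG: "B \<subseteq> span_over R ?FG" using S'(3) span_over_mono by blast
  have "1 \<in> v_closure R ?FG"
    using B(4) v_closure_mono[OF BFG] by (auto simp: v_closure_span_over)
  moreover have "\<not> ?FG \<subseteq> {0}" using BFG B(3) span_over_eq_zero_iff[of ?FG] by blast
  moreover have "?FG \<subseteq> R"
  proof -
    have "f * g \<in> R" if "f \<in> F" "g \<in> G" for f g
      using G(2) that unfolding colon_def mult.commute[of f g] by blast
    then show ?thesis by blast
  qed
  ultimately show ?thesis using G by blast
qed

section \<open>\<open>t\<close>-linked overrings of a Pruefer \<open>v\<close>-multiplication domain\<close>

text \<open>
  Let \<open>x\<close> be in the divisorial closure over \<open>R\<close> of a finite \<open>F \<subseteq> N \<inter> R\<close>, and let \<open>B\<close> consist of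
  products of \<open>F\<close> and \<open>(R : F)\<close> with divisorial closure \<open>R\<close>. Then \<open>xB \<subseteq> FR \<subseteq> N\<close>, and by
  linkedness \<open>B\<close> also has divisorial closure \<open>T\<close> over \<open>T\<close>. As \<open>N\<close> is a \<open>t\<close>-ideal, \<open>x \<in> N\<close>.
\<close>

lemma t_linked_contraction_t_prime:
  assumes L: "t_linked_overring R T" and N: "t_prime T N"
  shows "t_prime R (N \<inter> R)"
proof -
  have T: "overring R T" using L by (simp add: t_linked_overring_def)
  interpret T: quotient_field_domain T using overring_domain[OF T] .
  have sub: "R \<subseteq> T" using T by (simp add: overring_def)
  note prime = T.t_prime_prime[OF N]
  note NI = T.prime_ideal[OF prime]
  note NR = contraction_prime[OF T prime]
  have "N \<noteq> {0}" using T.t_ideal_nonzero[OF T.t_prime_t_ideal[OF N]] by blast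
  then have nonzero: "N \<inter> R \<noteq> {0}" using contraction_nonzero[OF T NI] by blast
  have "x \<in> N" if F: "finite F" "F \<subseteq> N \<inter> R" "\<not> F \<subseteq> {0}" and x: "x \<in> v_closure R F" for F x
  proof (cases "x = 0")
    case True
    then show ?thesis using T.ideal_zero[OF NI] by simp
  next
    case False
    obtain G where G: "finite G" "G \<subseteq> colon R F" and
      B: "{f * g |f g. f \<in> F \<and> g \<in> G} \<subseteq> R" "\<not> {f * g |f g. f \<in> F \<and> g \<in> G} \<subseteq> {0}"
        "1 \<in> v_closure R {f * g |f g. f \<in> F \<and> g \<in> G}"
      using finite_t_invertible[OF F(1,3)] by blast
    define B where "B = {f * g |f g. f \<in> F \<and> g \<in> G}"
    have "B = (\<lambda>(f, g). f * g) ` (F \<times> G)" by (auto simp: B_def)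
    then have fin: "finite B" using F(1) G(1) by simp
    have "colon R B = R" using one_mem_v_closure_iff[of B] B unfolding B_def by blast
    then have "colon T B = T" using L fin B unfolding t_linked_overring_iff B_def by blast
    then have "1 \<in> v_closure T B"
      using T.one_mem_v_closure_iff[of B] B(1) sub unfolding B_def by blast
    then have "x * 1 \<in> v_closure T ((*) x ` B)" by (rule T.v_closure_scale)
    moreover have "(*) x ` B \<subseteq> N"
    proof -
      have "x * (f * g) \<in> N" if "f \<in> F" "g \<in> G" for f g
      proof -
        have "x * g \<in> R"
          using x G(2) that unfolding v_closure_def colon_def[of R "colon R F"] by blast
        then have "(x * g) * f \<in> N" using T.ideal_mult[OF NI] F(2) that sub by blast
        then show ?thesis by (simp add: algebra_simps)
      qed
      then show ?thesis by (auto simp: B_def)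
    qed
    moreover have "\<not> (*) x ` B \<subseteq> {0}"
    proof -
      obtain z where "z \<in> B" "z \<noteq> 0" using B(2) unfolding B_def by blast
      then have "x * z \<in> (*) x ` B" "x * z \<noteq> 0" using False by simp_all
      then show ?thesis by blast
    qed
    ultimately show ?thesis
      using T.t_ideal_v_closure[OF T.t_prime_t_ideal[OF N], of "(*) x ` B"] fin by auto
  qed
  moreover have "v_closure R F \<subseteq> R" if "F \<subseteq> N \<inter> R" for F
    using v_closure_subset_domain that by blast
  ultimately have "t_ideal R (N \<inter> R)"
    using prime_ideal[OF NR] nonzero unfolding t_ideal_iff by blast
  then show ?thesis using NR by (simp add: t_prime_def)
qed

lemma t_linked_localize:
  assumes L: "t_linked_overring R T" and N: "t_prime T N"
  shows "localize T N = localize R (N \<inter> R)"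
proof -
  have T: "overring R T" using L by (simp add: t_linked_overring_def)
  interpret T: quotient_field_domain T using overring_domain[OF T] .
  show ?thesis
    by (rule localize_overring_eq[OF T T.t_prime_prime[OF N]
          valuation_domain_t_prime[OF t_linked_contraction_t_prime[OF L N]]])
qed

lemma t_linked_imp_Inter_localize:
  assumes L: "t_linked_overring R T"
  shows "T = (\<Inter>M\<in>t_Max T. localize R (M \<inter> R))"
proof -
  have T: "overring R T" using L by (simp add: t_linked_overring_def)
  interpret T: quotient_field_domain T using overring_domain[OF T] .
  show ?thesis
    using T.Inter_localize_t_Max t_linked_localize[OF L T.t_Max_t_prime] by simp
qed

text \<open>
  Being an intersection of localizations, a \<open>t\<close>-flat overring is \<open>t\<close>-linked. The same holds for
  \<open>t\<close>-subintersections, so over \<open>R\<close> the three kinds of overrings coincide.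
\<close>

lemma t_flat_overring_iff_t_linked: "t_flat_overring R T \<longleftrightarrow> t_linked_overring R T"
proof
  assume F: "t_flat_overring R T"
  then have T: "overring R T" by (simp add: t_flat_overring_def)
  interpret T: quotient_field_domain T using overring_domain[OF T] .
  define \<P> where "\<P> = (\<lambda>M. M \<inter> R) ` t_Max T"
  have "P \<in> \<P> \<Longrightarrow> primeideal P (ring_on R)" for P
    using contraction_prime[OF T] T.t_Max_t_prime T.t_prime_prime unfolding \<P>_def by blast
  then have "t_linked_overring R (\<Inter>P\<in>\<P>. localize R P)" by (rule t_linked_Inter_localize)
  moreover have "(\<Inter>P\<in>\<P>. localize R P) = T"
    using T.Inter_localize_t_Max F by (simp add: \<P>_def t_flat_overring_def image_image)
  ultimately show "t_linked_overring R T" by simp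
next
  assume L: "t_linked_overring R T"
  then have T: "overring R T" by (simp add: t_linked_overring_def)
  interpret T: quotient_field_domain T using overring_domain[OF T] .
  show "t_flat_overring R T"
    using T t_linked_localize[OF L T.t_Max_t_prime] by (simp add: t_flat_overring_def)
qed

lemma t_subintersection_iff_t_linked: "t_subintersection R T \<longleftrightarrow> t_linked_overring R T"
proof
  assume "t_subintersection R T"
  then obtain \<P> where P: "\<forall>P\<in>\<P>. t_prime R P" and T: "T = (\<Inter>P\<in>\<P>. localize R P)"
    unfolding t_subintersection_def by blast
  then show "t_linked_overring R T"
    unfolding T by (intro t_linked_Inter_localize t_prime_prime) simp
next
  assume L: "t_linked_overring R T"
  then have T: "overring R T" by (simp add: t_linked_overring_def)
  interpret T: quotient_field_domain T using overring_domain[OF T] .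
  define \<P> where "\<P> = (\<lambda>M. M \<inter> R) ` t_Max T"
  have "\<forall>P\<in>\<P>. t_prime R P"
    using t_linked_contraction_t_prime[OF L T.t_Max_t_prime] unfolding \<P>_def by blast
  moreover have "T = (\<Inter>P\<in>\<P>. localize R P)"
    using t_linked_imp_Inter_localize[OF L] by (simp add: \<P>_def image_image)
  ultimately show "t_subintersection R T"
    unfolding t_subintersection_def by (intro exI[of _ \<P>] conjI)
qed

lemma t_linked_overring: "t_linked_overring R T \<Longrightarrow> overring R T"
  by (simp add: t_linked_overring_def)

text \<open>
  The localizations of \<open>T\<close> at its maximal \<open>t\<close>-ideals are localizations of \<open>R\<close>, and a localization
  determines its prime. So \<open>t\<close>-Max\<open>(T)\<close> may be replaced by its set of contractions, an antichain
  of \<open>t\<close>-primes of \<open>R\<close>.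
\<close>

lemma t_Max_contractions_eq_iff:
  assumes L: "t_linked_overring R T" and M: "M \<in> t_Max T" "N \<in> t_Max T"
  shows "M \<inter> R \<subseteq> N \<inter> R \<longleftrightarrow> M = N"
proof
  note T = t_linked_overring[OF L]
  interpret T: quotient_field_domain T using overring_domain[OF T] .
  note p = T.t_prime_prime[OF T.t_Max_t_prime]
  assume "M \<inter> R \<subseteq> N \<inter> R"
  then have "localize R (N \<inter> R) \<subseteq> localize R (M \<inter> R)"
    by (intro localize_antimono contraction_prime[OF T] p M)
  then have "localize T N \<subseteq> localize T M"
    using t_linked_localize[OF L T.t_Max_t_prime] M by simp
  then have "M \<subseteq> N" using T.localize_subset_imp p M by blast
  then show "M = N" using T.t_Max_subset_imp_eq M by blast
qed simp

lemma incomparable_t_Max_contractions: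
  assumes L: "t_linked_overring R T"
  shows "incomparable_t_primes R (t_Max_contractions R T)"
proof -
  interpret T: quotient_field_domain T using overring_domain[OF t_linked_overring[OF L]] .
  have "t_prime R (M \<inter> R)" if "M \<in> t_Max T" for M
    using t_linked_contraction_t_prime[OF L T.t_Max_t_prime[OF that]] .
  then show ?thesis
    using t_Max_contractions_eq_iff[OF L]
    unfolding incomparable_t_primes_def pairwise_def by auto
qed

lemma Inter_localize_t_Max_contractions:
  assumes L: "t_linked_overring R T"
  shows "(\<Inter>P\<in>t_Max_contractions R T. localize R P) = T"
  using t_linked_imp_Inter_localize[OF L] by (auto simp: setcompr_eq_image image_image)

lemma exists_t_prime_over:
  assumes T: "overring R T" and P: "t_prime R P" and sub: "T \<subseteq> localize R P"
  shows "\<exists>Q. t_prime T Q \<and> Q \<inter> R = P \<and> localize T Q = localize R P"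
proof -
  interpret T: quotient_field_domain T using overring_domain[OF T] .
  obtain Q where Q: "primeideal Q (ring_on T)" "Q \<inter> R = P" "localize T Q = localize R P"
    using exists_prime_over[OF T t_prime_prime[OF P] sub] by blast
  have "Q \<noteq> {0}" using Q(2) t_ideal_nonzero[OF t_prime_t_ideal[OF P]] by blast
  then have "t_prime T Q"
    using T.t_prime_if_valuation_domain[OF Q(1)] Q(3) valuation_domain_t_prime[OF P] by simp
  then show ?thesis using Q by blast
qed

lemma exists_t_Max_contraction_above:
  assumes T: "overring R T" and P: "t_prime R P" and sub: "T \<subseteq> localize R P"
  shows "\<exists>Q\<in>t_Max_contractions R T. P \<subseteq> Q"
proof -
  interpret T: quotient_field_domain T using overring_domain[OF T] .
  obtain Q where Q: "t_prime T Q" "Q \<inter> R = P" using exists_t_prime_over[OF assms] by blast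
  obtain M where "M \<in> t_Max T" "Q \<subseteq> M" using T.t_prime_subset_t_Max[OF Q(1)] by blast
  then show ?thesis using Q(2) by (intro bexI[of _ "M \<inter> R"]) auto
qed

lemma t_sharp_domain_iff_contractions:
  assumes L: "t_linked_overring R T"
  shows "t_sharp_domain T \<longleftrightarrow>
    (\<forall>Q\<in>t_Max_contractions R T.
       \<not> (\<Inter>P\<in>t_Max_contractions R T - {Q}. localize R P) \<subseteq> localize R Q)"
proof -
  interpret T: quotient_field_domain T using overring_domain[OF t_linked_overring[OF L]] .
  have loc: "localize T M = localize R (M \<inter> R)" if "M \<in> t_Max T" for M
    using t_linked_localize[OF L T.t_Max_t_prime[OF that]] .
  have "t_Max_contractions R T - {M \<inter> R} = (\<lambda>N. N \<inter> R) ` (t_Max T - {M})" if "M \<in> t_Max T" for M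
    using t_Max_contractions_eq_iff[OF L] that by (auto simp: setcompr_eq_image)
  then have "(\<Inter>P\<in>t_Max_contractions R T - {M \<inter> R}. localize R P) =
      (\<Inter>N\<in>t_Max T - {M}. localize T N)" if "M \<in> t_Max T" for M
    using that loc by simp
  then show ?thesis unfolding T.t_sharp_domain_iff using loc by (auto simp: setcompr_eq_image)
qed

section \<open>Separating a \<open>t\<close>-prime from a set of primes\<close>

text \<open>
  If a finite part \<open>F\<close> of \<open>Q\<close> is contained in no member of \<open>\<Lambda>\<close>, then \<open>(R : F)\<close> is contained in
  every \<open>R\<^sub>P\<close> with \<open>P \<in> \<Lambda>\<close>, but not in \<open>R\<^sub>Q\<close>, where \<open>F\<close> generates a proper principal ideal.
\<close>

lemma Inter_localize_not_subset:
  assumes Q: "t_prime R Q" and P: "\<And>P. P \<in> \<Lambda> \<Longrightarrow> primeideal P (ring_on R)"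
    and F: "finite F" "F \<subseteq> Q" "\<And>P. P \<in> \<Lambda> \<Longrightarrow> \<not> F \<subseteq> P"
  shows "\<not> (\<Inter>P\<in>\<Lambda>. localize R P) \<subseteq> localize R Q"
proof -
  note QI = prime_ideal[OF t_prime_prime[OF Q]]
  obtain c where c: "c \<in> Q" "c \<noteq> 0" using t_ideal_nonzero[OF t_prime_t_ideal[OF Q]] by blast
  \<comment> \<open>\<open>c\<close> is adjoined because \<open>F\<close> may be zero when \<open>\<Lambda>\<close> is empty\<close>
  obtain a b where ab: "a \<in> insert c F" "b \<in> colon R (insert c F)" "a * b \<in> R" "a * b \<notin> Q"
    using exists_local_inverse[OF t_prime_prime[OF Q] valuation_domain_t_prime[OF Q],
        of "insert c F"] F(1) c by auto
  have "b \<in> localize R P" if "P \<in> \<Lambda>" for P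
  proof -
    obtain s where s: "s \<in> F" "s \<notin> P" using F(3)[OF \<open>P \<in> \<Lambda>\<close>] by blast
    then have "s \<in> R" "s * b \<in> R"
      using ab(2) F(2) ideal_subset[OF QI] by (auto simp: colon_def mult.commute)
    then show ?thesis using mem_localize_iff[OF prime_ideal[OF P[OF that]]] s(2) by blast
  qed
  moreover have "b \<notin> localize R Q"
  proof
    assume "b \<in> localize R Q"
    then obtain s where s: "s \<in> R" "s \<notin> Q" "s * b \<in> R" using mem_localize_iff[OF QI] by blast
    have "a \<in> Q" using ab(1) c(1) F(2) by blast
    then have "(s * b) * a \<in> Q" using ideal_mult[OF QI s(3)] by blast
    then have "s * (a * b) \<in> Q" by (simp add: algebra_simps)
    then show False using prime_mult[OF t_prime_prime[OF Q] s(1) ab(3)] s(2) ab(4) by blast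
  qed
  ultimately show ?thesis by blast
qed

text \<open>
  Conversely, an element \<open>u\<close> of all \<open>R\<^sub>M\<close> but not of \<open>R\<^sub>P\<close> gives a conductor inside \<open>P\<close> and not
  in any \<open>M\<close>. The conductor is \<open>(R : {1, u})\<close>, so \<open>t\<close>-invertibility of \<open>{1, u}\<close> replaces it by a
  finite subset.
\<close>

lemma exists_finite_subset_conductor:
  "\<exists>G. finite G \<and> G \<subseteq> conductor R u \<and> (\<forall>M\<in>t_Max R. u \<in> localize R M \<longrightarrow> \<not> G \<subseteq> M)"
proof -
  obtain G where G: "finite G" "G \<subseteq> colon R {1, u}"
    and one: "\<not> {f * g |f g. f \<in> {1, u} \<and> g \<in> G} \<subseteq> {0}"
      "1 \<in> v_closure R {f * g |f g. f \<in> {1, u} \<and> g \<in> G}"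
    using finite_t_invertible[of "{1, u}"] by auto
  have Gc: "G \<subseteq> conductor R u" using G(2) by (auto simp: conductor_def colon_def)
  have "\<not> G \<subseteq> M" if M: "M \<in> t_Max R" and u: "u \<in> localize R M" for M
  proof
    assume GM: "G \<subseteq> M"
    note prime = t_prime_prime[OF t_Max_t_prime[OF M]]
    note MI = prime_ideal[OF prime]
    obtain s where s: "s \<in> R" "s \<notin> M" "s * u \<in> R" using u mem_localize_iff[OF MI] by blast
    have "u * g \<in> M" if "g \<in> G" for g
    proof -
      have "(s * u) * g \<in> M" using ideal_mult[OF MI s(3)] GM that by blast
      then have "s * (u * g) \<in> M" by (simp add: mult.assoc)
      moreover have "u * g \<in> R" using Gc that by (auto simp: conductor_def mult.commute)
      ultimately show ?thesis using prime_mult[OF prime s(1)] s(2) by blast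
    qed
    then have sub: "{f * g |f g. f \<in> {1, u} \<and> g \<in> G} \<subseteq> M" using GM by auto
    have "{f * g |f g. f \<in> {1, u} \<and> g \<in> G} = (\<lambda>g. 1 * g) ` G \<union> (*) u ` G" by blast
    then have "finite {f * g |f g. f \<in> {1, u} \<and> g \<in> G}" using G(1) by simp
    then have "1 \<in> M"
      using t_ideal_v_closure[OF t_Max_t_ideal[OF M] _ sub one(1)] one(2) by blast
    then show False using t_Max_one[OF M] by blast
  qed
  then show ?thesis using G(1) Gc by blast
qed

text \<open>
  A counterexample can be enlarged to a \<open>t\<close>-prime \<open>Q\<close>. The finite part \<open>F\<close> of \<open>Q\<close> is contained
  only in maximal \<open>t\<close>-ideals that contain \<open>Q\<close>. So a member of \<open>\<Lambda>\<close> that contains \<open>F\<close> lies below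
  the same maximal \<open>t\<close>-ideal as \<open>Q\<close>, is comparable with \<open>Q\<close> and hence contained in it. The primes
  below \<open>Q\<close> form a chain, so the antichain \<open>\<Lambda>\<close> has at most one such member, and adding a single
  element of \<open>Q\<close> to \<open>F\<close> escapes from it too.
\<close>

lemma incomparable_t_primes_finite_escape:
  assumes finite_part: "\<And>P. t_prime R P \<Longrightarrow>
      \<exists>F. finite F \<and> F \<subseteq> P \<and> (\<forall>M\<in>t_Max R. \<not> P \<subseteq> M \<longrightarrow> \<not> F \<subseteq> M)"
    and \<Lambda>: "incomparable_t_primes R \<Lambda>" and I: "I \<in> Phi R \<Lambda>"
  shows "\<exists>F. finite F \<and> F \<subseteq> I \<and> (\<forall>P\<in>\<Lambda>. \<not> F \<subseteq> P)"
proof (rule ccontr)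
  assume no: "\<not> ?thesis"
  have t: "t_prime R P" if "P \<in> \<Lambda>" for P
    by (rule incomparable_t_primesD[OF \<Lambda> that])
  have tI: "t_ideal R I" using I by (simp add: Phi_def)
  have all: "\<exists>P\<in>\<Lambda>. F \<subseteq> P" if "finite F" "F \<subseteq> I" for F using no that by blast
  have "\<exists>Q. t_prime R Q \<and> I \<subseteq> Q \<and> (\<forall>F. finite F \<longrightarrow> F \<subseteq> Q \<longrightarrow> (\<exists>P\<in>\<Lambda>. F \<subseteq> P))"
    by (rule exists_t_prime_without_finite_escape[OF t_prime_prime[OF t] tI all])
  then obtain Q where Q: "t_prime R Q" "I \<subseteq> Q"
      and noescape: "\<forall>F. finite F \<longrightarrow> F \<subseteq> Q \<longrightarrow> (\<exists>P\<in>\<Lambda>. F \<subseteq> P)"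
    by (elim exE conjE)
  have QP: "\<not> Q \<subseteq> P" if "P \<in> \<Lambda>" for P
    using I Q(2) that by (auto simp: Phi_def)
  obtain F where F: "finite F" "F \<subseteq> Q" "\<forall>M\<in>t_Max R. \<not> Q \<subseteq> M \<longrightarrow> \<not> F \<subseteq> M"
    using finite_part[OF Q(1)] by blast
  have below: "P \<subseteq> Q" if P: "P \<in> \<Lambda>" "F \<subseteq> P" for P
  proof -
    obtain M where M: "M \<in> t_Max R" "P \<subseteq> M" using t_prime_subset_t_Max[OF t[OF P(1)]] by blast
    then have "Q \<subseteq> M" using F(3) P(2) by blast
    then show ?thesis
      using t_primes_below_comparable[OF t_Max_t_prime[OF M(1)] Q(1) t[OF P(1)] _ M(2)] QP[OF P(1)]
      by blast
  qed
  obtain P where P: "P \<in> \<Lambda>" "F \<subseteq> P" using noescape[rule_format, OF F(1,2)] by blast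
  obtain q where q: "q \<in> Q" "q \<notin> P" using QP[OF P(1)] by blast
  obtain P' where P': "P' \<in> \<Lambda>" "insert q F \<subseteq> P'"
    using noescape[rule_format, of "insert q F"] F q by auto
  have "P \<subseteq> P' \<or> P' \<subseteq> P"
    using t_primes_below_comparable[OF Q(1) t[OF P(1)] t[OF P'(1)]] below P P' by blast
  then have "P = P'"
    using incomparable_t_primes_eq[OF \<Lambda> P(1) P'(1)] incomparable_t_primes_eq[OF \<Lambda> P'(1) P(1)] by blast
  then show False using P'(2) q(2) by blast
qed

section \<open>Consequences of finite escape\<close>

text \<open>
  If \<open>Q\<close> is the contraction of a maximal \<open>t\<close>-ideal of \<open>T\<close>, then \<open>T \<subseteq> R\<^sub>Q\<close> and so \<open>Q\<close> cannot
  escape from \<open>\<Lambda>\<close>: it lies in a member of \<open>\<Lambda>\<close>. Each member of \<open>\<Lambda>\<close> lies in turn in such a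
  contraction. As both sets are antichains, they are equal.
\<close>

lemma incomparable_eq_t_Max_contractions:
  assumes L: "t_linked_overring R T"
    and \<Lambda>: "incomparable_t_primes R \<Lambda>" and T: "T = (\<Inter>P\<in>\<Lambda>. localize R P)"
    and v: "v_finite R (Phi R \<Lambda>)"
  shows "\<Lambda> = t_Max_contractions R T"
proof -
  let ?C = "t_Max_contractions R T"
  have t: "t_prime R P" if "P \<in> \<Lambda>" for P
    by (rule incomparable_t_primesD[OF \<Lambda> that])
  have tC: "t_prime R Q" if "Q \<in> ?C" for Q
    by (rule incomparable_t_primesD[OF incomparable_t_Max_contractions[OF L] that])
  have up: "\<exists>Q\<in>?C. P \<subseteq> Q" if "P \<in> \<Lambda>" for P
    using exists_t_Max_contraction_above[OF t_linked_overring[OF L] t[OF that]] T that by blast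
  have down: "\<exists>P\<in>\<Lambda>. Q \<subseteq> P" if Q: "Q \<in> ?C" for Q
  proof (rule ccontr)
    assume "\<not> ?thesis"
    then have QPhi: "Q \<in> Phi R \<Lambda>"
      using t_prime_t_ideal[OF tC[OF Q]] unfolding Phi_def by blast
    have "\<forall>P\<in>\<Lambda>. t_prime R P" using t by blast
    from v_finite_PhiD[OF v this QPhi]
    obtain F where F: "finite F" "F \<subseteq> Q" "\<forall>P\<in>\<Lambda>. \<not> F \<subseteq> P"
      by (elim exE conjE)
    have "\<not> (\<Inter>P\<in>\<Lambda>. localize R P) \<subseteq> localize R Q"
      by (rule Inter_localize_not_subset[OF tC[OF Q] t_prime_prime[OF t] F(1,2) bspec[OF F(3)]])
    then show False using Inter_localize_t_Max_contractions[OF L] Q T by blast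
  qed
  show ?thesis
  proof (intro subset_antisym subsetI)
    fix P assume P: "P \<in> \<Lambda>"
    then obtain Q P' where "Q \<in> ?C" "P \<subseteq> Q" "P' \<in> \<Lambda>" "Q \<subseteq> P'" using up down by meson
    then have "P = P'" using incomparable_t_primes_eq[OF \<Lambda> P] by (meson subset_trans)
    then have "P = Q" using \<open>P \<subseteq> Q\<close> \<open>Q \<subseteq> P'\<close> by blast
    then show "P \<in> ?C" using \<open>Q \<in> ?C\<close> by (rule ssubst)
  next
    fix Q assume Q: "Q \<in> ?C"
    then obtain P Q' where "P \<in> \<Lambda>" "Q \<subseteq> P" "Q' \<in> ?C" "P \<subseteq> Q'" using up down by meson
    then have "Q = Q'"
      using incomparable_t_primes_eq[OF incomparable_t_Max_contractions[OF L] Q] by (meson subset_trans)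
    then have "Q = P" using \<open>Q \<subseteq> P\<close> \<open>P \<subseteq> Q'\<close> by blast
    then show "Q \<in> \<Lambda>" using \<open>P \<in> \<Lambda>\<close> by (rule ssubst)
  qed
qed

text \<open>
  In the antichain of contractions each member escapes from all the others, so none of them can
  be left out of the intersection.
\<close>

lemma t_sharp_domain_if_v_finite:
  assumes L: "t_linked_overring R T"
    and v: "\<And>\<Lambda>. incomparable_t_primes R \<Lambda> \<Longrightarrow> v_finite R (Phi R \<Lambda>)"
  shows "t_sharp_domain T"
proof -
  define \<C> where "\<C> = t_Max_contractions R T"
  have inc: "incomparable_t_primes R \<C>"
    unfolding \<C>_def by (rule incomparable_t_Max_contractions[OF L])
  have "\<not> (\<Inter>P\<in>\<C> - {Q}. localize R P) \<subseteq> localize R Q" if Q: "Q \<in> \<C>" for Q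
  proof -
    have inc': "incomparable_t_primes R (\<C> - {Q})"
      by (rule incomparable_t_primes_subset[OF inc Diff_subset])
    note t = incomparable_t_primesD[OF inc']
    note tQ = incomparable_t_primesD[OF inc Q]
    have "\<not> Q \<subseteq> P" if "P \<in> \<C> - {Q}" for P
      using incomparable_t_primes_eq[OF inc Q, of P] that by auto
    then have QPhi: "Q \<in> Phi R (\<C> - {Q})"
      using t_prime_t_ideal[OF tQ] unfolding Phi_def by blast
    have "\<forall>P\<in>\<C> - {Q}. t_prime R P" using t by blast
    from v_finite_PhiD[OF v[OF inc'] this QPhi]
    obtain F where F: "finite F" "F \<subseteq> Q" "\<forall>P\<in>\<C> - {Q}. \<not> F \<subseteq> P"
      by (elim exE conjE)
    show ?thesis
      by (rule Inter_localize_not_subset[OF tQ t_prime_prime[OF t] F(1,2) bspec[OF F(3)]])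
  qed
  then show ?thesis unfolding t_sharp_domain_iff_contractions[OF L] \<C>_def by blast
qed

lemma t_flat_incomparable_eq_t_Max:
  assumes L: "t_linked_overring R T"
    and v: "\<And>\<Lambda>. incomparable_t_primes R \<Lambda> \<Longrightarrow> v_finite R (Phi R \<Lambda>)"
    and \<Lambda>: "incomparable_t_primes T \<Lambda>" and T: "T = (\<Inter>Q\<in>\<Lambda>. localize T Q)"
  shows "\<Lambda> = t_Max T"
proof -
  note over = t_linked_overring[OF L]
  interpret T: quotient_field_domain T using overring_domain[OF over] .
  have t: "t_prime T Q" if "Q \<in> \<Lambda>" for Q
    by (rule incomparable_t_primesD[OF \<Lambda> that])
  have inj: "P \<subseteq> Q" if "t_prime T P" "t_prime T Q" "P \<inter> R \<subseteq> Q \<inter> R" for P Q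
  proof (rule T.localize_subset_imp[OF T.t_prime_prime T.t_prime_prime])
    show "localize T Q \<subseteq> localize T P"
      using localize_antimono[OF contraction_prime[OF over T.t_prime_prime]
          contraction_prime[OF over T.t_prime_prime] that(3)] that t_linked_localize[OF L] by simp
  qed (use that in blast)+
  let ?L = "(\<lambda>Q. Q \<inter> R) ` \<Lambda>"
  have "incomparable_t_primes R ?L"
  proof (rule incomparable_t_primesI)
    fix P P' assume "P \<in> ?L" "P' \<in> ?L" and sub: "P \<subseteq> P'"
    then obtain Q Q' where Q: "Q \<in> \<Lambda>" "P = Q \<inter> R" "Q' \<in> \<Lambda>" "P' = Q' \<inter> R" by blast
    then have "Q \<subseteq> Q'" using inj[OF t t] sub by blast
    then show "P = P'" using incomparable_t_primes_eq[OF \<Lambda> Q(1,3)] Q(2,4) by simp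
  qed (use t_linked_contraction_t_prime[OF L t] in blast)
  moreover have "T = (\<Inter>P\<in>?L. localize R P)"
    using T t_linked_localize[OF L t] by (simp add: image_image)
  ultimately have eq: "?L = t_Max_contractions R T"
    using incomparable_eq_t_Max_contractions[OF L] v by blast
  have equal: "P = Q" if "t_prime T P" "t_prime T Q" "P \<inter> R = Q \<inter> R" for P Q
    using inj[OF that(1,2)] inj[OF that(2,1)] that(3) by simp
  show ?thesis
  proof (intro subset_antisym subsetI)
    fix Q assume Q: "Q \<in> \<Lambda>"
    then have "Q \<inter> R \<in> t_Max_contractions R T" using eq by blast
    then obtain M where "Q \<inter> R = M \<inter> R" "M \<in> t_Max T" by blast
    then show "Q \<in> t_Max T" using equal[OF t[OF Q] T.t_Max_t_prime] by metis
  next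
    fix M assume M: "M \<in> t_Max T"
    then have "M \<inter> R \<in> ?L" using eq by blast
    then obtain Q where "M \<inter> R = Q \<inter> R" "Q \<in> \<Lambda>" by blast
    then show "M \<in> \<Lambda>" using equal[OF T.t_Max_t_prime[OF M] t] by metis
  qed
qed

section \<open>The overring attached to a \<open>t\<close>-prime that is not separated\<close>

text \<open>
  If \<open>yB \<subseteq> (P : P)\<close> and \<open>(R : B) = R\<close>, then \<open>(yp)B \<subseteq> P\<close> for \<open>p \<in> P\<close>, so \<open>yp \<in> R\<close>. As \<open>B\<close> is not
  contained in the \<open>t\<close>-prime \<open>P\<close>, even \<open>yp \<in> P\<close>.
\<close>

lemma t_linked_colon:
  assumes P: "t_prime R P"
  shows "t_linked_overring R (colon P P)"
  unfolding t_linked_overring_iff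
proof (intro conjI allI impI)
  note PI = prime_ideal[OF t_prime_prime[OF P]]
  have minus: "- x \<in> P" if "x \<in> P" for x
    using ideal_mult[OF PI uminus_closed[OF one_closed] that] by simp
  show "overring R (colon P P)"
    using ideal_mult[OF PI] ideal_add[OF PI] minus
    by (auto simp: overring_def subring_iff colon_def distrib_right mult.assoc)
  fix B assume B: "finite B \<and> B \<subseteq> R \<and> \<not> B \<subseteq> {0} \<and> colon R B = R"
  show "colon (colon P P) B = colon P P"
  proof
    show "colon P P \<subseteq> colon (colon P P) B"
      using B ideal_mult[OF PI] by (auto simp: colon_def mult.assoc subset_iff)
    show "colon (colon P P) B \<subseteq> colon P P"
    proof
      fix y assume y: "y \<in> colon (colon P P) B"
      have "y * p \<in> P" if p: "p \<in> P" for p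
      proof -
        have yp: "(y * p) * b \<in> P" if "b \<in> B" for b
        proof -
          have "(y * b) * p \<in> P" using y p that by (auto simp: colon_def)
          then show ?thesis by (simp add: mult_ac)
        qed
        then have "y * p \<in> colon R B" using ideal_subset[OF PI] by (auto simp: colon_def)
        then have "y * p \<in> R" using B by blast
        moreover have "\<not> B \<subseteq> P"
          using t_ideal_v_closure[OF t_prime_t_ideal[OF P], of B] B one_mem_v_closure_iff[of B]
            prime_one[OF t_prime_prime[OF P]] by blast
        ultimately show ?thesis using yp prime_mult[OF t_prime_prime[OF P]] B by blast
      qed
      then show "y \<in> colon P P" by (simp add: colon_def)
    qed
  qed
qed

text \<open>
  At a maximal \<open>t\<close>-ideal \<open>M \<supseteq> P\<close> the ideals \<open>PR\<^sub>M\<close> and \<open>PR\<^sub>P\<close> coincide, because \<open>R\<^sub>M\<close> is a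
  valuation domain. So an element of the right hand side multiplies \<open>P\<close> into every \<open>R\<^sub>M\<close>, hence
  into \<open>R \<inter> PR\<^sub>P = P\<close>. Conversely, if \<open>xP \<subseteq> P\<close> and \<open>p \<in> P\<close> is not in \<open>M\<close>, then \<open>x = (xp)/p\<close> is in
  \<open>R\<^sub>M\<close>; and \<open>x\<close> is in \<open>R\<^sub>P\<close>, since otherwise \<open>x\<^sup>-\<^sup>1 \<in> PR\<^sub>P\<close> and \<open>1 = x x\<^sup>-\<^sup>1\<close> would be in
  \<open>PR\<^sub>P\<close>.
\<close>

lemma colon_self_eq:
  assumes P: "t_prime R P"
  shows "colon P P = localize R P \<inter> (\<Inter>M\<in>{M \<in> t_Max R. \<not> P \<subseteq> M}. localize R M)"
proof
  note prime = t_prime_prime[OF P]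
  note PI = prime_ideal[OF prime]
  show "colon P P \<subseteq> localize R P \<inter> (\<Inter>M\<in>{M \<in> t_Max R. \<not> P \<subseteq> M}. localize R M)"
  proof (intro subsetI IntI INT_I)
    fix x M assume x: "x \<in> colon P P" and "M \<in> {M \<in> t_Max R. \<not> P \<subseteq> M}"
    then have M: "M \<in> t_Max R" "\<not> P \<subseteq> M" by auto
    obtain p where p: "p \<in> P" "p \<notin> M" using M(2) by blast
    then have "x * p \<in> P" using x by (auto simp: colon_def)
    then show "x \<in> localize R M"
      using p ideal_subset[OF PI] mem_localize_iff[OF t_ideal_ideal[OF t_Max_t_ideal[OF M(1)]], of x]
      by (metis mult.commute)
  next
    fix x assume x: "x \<in> colon P P"
    show "x \<in> localize R P"
    proof (rule ccontr)
      assume nx: "x \<notin> localize R P"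
      then have "x \<noteq> 0" using subsetD[OF subset_localize[OF prime] zero_closed] by blast
      then have "inverse x \<in> localize R P"
        using valuation_domain_t_prime[OF P] nx by (auto simp: valuation_domain_def)
      then obtain s where s: "s \<in> R" "s \<notin> P" "s * inverse x \<in> R" using mem_localize_iff[OF PI] by blast
      have "s * inverse x \<in> P"
      proof (rule ccontr)
        assume "s * inverse x \<notin> P"
        moreover have "(s * inverse x) * x \<in> R" using s(1) \<open>x \<noteq> 0\<close> by (simp add: mult.assoc)
        ultimately show False using nx s(3) mem_localize_iff[OF PI] by blast
      qed
      then have "x * (s * inverse x) \<in> P" using x by (auto simp: colon_def)
      then show False using s(2) \<open>x \<noteq> 0\<close> by (simp add: mult.left_commute[of x])
    qed
  qed
  show "localize R P \<inter> (\<Inter>M\<in>{M \<in> t_Max R. \<not> P \<subseteq> M}. localize R M) \<subseteq> colon P P"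
  proof
    fix x assume x: "x \<in> localize R P \<inter> (\<Inter>M\<in>{M \<in> t_Max R. \<not> P \<subseteq> M}. localize R M)"
    then obtain s where s: "s \<in> R" "s \<notin> P" "s * x \<in> R" using mem_localize_iff[OF PI] by blast
    have "x * p \<in> P" if p: "p \<in> P" for p
    proof -
      have pR: "p \<in> R" using ideal_subset[OF PI p] .
      have "x * p \<in> localize R M" if M: "M \<in> t_Max R" for M
      proof -
        note MI = t_ideal_ideal[OF t_Max_t_ideal[OF M]]
        show ?thesis
        proof (cases "P \<subseteq> M")
          case False
          then have "x \<in> localize R M" using x M by blast
          then obtain t where t: "t \<in> R" "t \<notin> M" "t * x \<in> R" using mem_localize_iff[OF MI] by blast
          have "t * (x * p) \<in> R" using mult_closed[OF t(3) pR] by (simp add: mult.assoc)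
          then show ?thesis using t mem_localize_iff[OF MI] by blast
        next
          case True
          have "s \<noteq> 0" using s(2) ideal_zero[OF PI] by blast
          have "p / s \<in> localize R M"
          proof (rule ccontr)
            assume np: "p / s \<notin> localize R M"
            have "0 \<in> localize R M"
              using subset_localize[OF t_prime_prime[OF t_Max_t_prime[OF M]]] zero_closed by blast
            then have "p \<noteq> 0" using np by auto
            then have "s / p \<in> localize R M"
              using valuation_domain_t_prime[OF t_Max_t_prime[OF M]] np \<open>s \<noteq> 0\<close>
              unfolding valuation_domain_def by (metis divide_eq_0_iff inverse_divide)
            then obtain t where t: "t \<in> R" "t \<notin> M" "t * (s / p) \<in> R"
              using mem_localize_iff[OF MI] by blast
            have "(t * (s / p)) * p \<in> P" by (rule ideal_mult[OF PI t(3) p])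
            then have "t * s \<in> P" using \<open>p \<noteq> 0\<close> by simp
            then show False using prime_mult[OF prime t(1) s(1)] t(2) s(2) True by blast
          qed
          then obtain t where t: "t \<in> R" "t \<notin> M" "t * (p / s) \<in> R"
            using mem_localize_iff[OF MI] by blast
          have "(t * (p / s)) * (s * x) \<in> R" by (rule mult_closed[OF t(3) s(3)])
          then have "t * (x * p) \<in> R" using \<open>s \<noteq> 0\<close> by (simp add: mult_ac)
          then show ?thesis using t mem_localize_iff[OF MI] by blast
        qed
      qed
      then have "x * p \<in> R" using Inter_localize_t_Max by blast
      moreover have "s * (x * p) \<in> P" using ideal_mult[OF PI s(3) p] by (simp add: mult.assoc)
      ultimately show ?thesis using prime_mult[OF prime s(1)] s(2) by blast
    qed
    then show "x \<in> colon P P" by (simp add: colon_def)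
  qed
qed

text \<open>
  Some contraction contains \<open>M\<close>; it is a proper \<open>t\<close>-ideal of \<open>R\<close>, so it equals \<open>M\<close>.
\<close>

lemma t_Max_subset_contractions:
  assumes W: "W \<subseteq> t_Max R"
  shows "W \<subseteq> t_Max_contractions R (\<Inter>M\<in>W. localize R M)"
proof
  let ?T = "\<Inter>M\<in>W. localize R M"
  have L: "t_linked_overring R ?T"
    using W t_Max_t_prime t_prime_prime by (intro t_linked_Inter_localize) blast
  fix M assume M: "M \<in> W"
  then obtain Q where Q: "Q \<in> t_Max_contractions R ?T" "M \<subseteq> Q"
    using exists_t_Max_contraction_above[OF t_linked_overring[OF L] t_Max_t_prime, of M] W by blast
  have "t_prime R Q"
    by (rule incomparable_t_primesD[OF incomparable_t_Max_contractions[OF L] Q(1)])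
  then have "Q = M"
    using t_Max_maximal[of M Q] Q(2) M W t_prime_t_ideal prime_one[OF t_prime_prime] by blast
  then show "M \<in> t_Max_contractions R ?T" using Q(1) by simp
qed

text \<open>
  Suppose \<open>T = \<Inter>R\<^sub>M\<close>, over the maximal \<open>t\<close>-ideals \<open>M\<close> not containing \<open>P\<close>, lies in \<open>R\<^sub>P\<close>. Each of
  these \<open>M\<close> is the contraction of a maximal \<open>t\<close>-ideal of \<open>T\<close>, but there is a further contraction:
  one that contains \<open>P\<close>. It can be left out of the intersection that represents \<open>T\<close>. So \<open>T\<close> is
  not a \<open>t#\<close>-domain, and \<open>T\<close> is the intersection of the localizations over two different
  antichains.
\<close>

context
  fixes P W T
  assumes P: "t_prime R P"
  defines "W \<equiv> {M \<in> t_Max R. \<not> P \<subseteq> M}"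
  defines "T \<equiv> \<Inter>M\<in>W. localize R M"
  assumes not_separated: "T \<subseteq> localize R P"
begin

lemma W_subset: "W \<subseteq> t_Max R"
  by (auto simp: W_def)

lemma t_linked_not_separated: "t_linked_overring R T"
  unfolding T_def using W_subset t_Max_t_prime t_prime_prime
  by (intro t_linked_Inter_localize) blast

lemma colon_self_not_separated: "colon P P = T"
  using colon_self_eq[OF P] not_separated unfolding T_def W_def by blast

lemma contractions_not_separated: "W \<subset> t_Max_contractions R T"
proof -
  obtain Q where "Q \<in> t_Max_contractions R T" "P \<subseteq> Q"
    using exists_t_Max_contraction_above[OF t_linked_overring[OF t_linked_not_separated] P not_separated]
    by blast
  then have "Q \<notin> W" by (simp add: W_def)
  then show ?thesis
    using t_Max_subset_contractions[OF W_subset] \<open>Q \<in> _\<close> unfolding T_def by blast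
qed

lemma not_t_sharp_domain_not_separated: "\<not> t_sharp_domain T"
proof
  assume sharp: "t_sharp_domain T"
  obtain Q where Q: "Q \<in> t_Max_contractions R T" "Q \<notin> W"
    using contractions_not_separated by blast
  have "(\<Inter>P\<in>t_Max_contractions R T - {Q}. localize R P) \<subseteq> (\<Inter>P\<in>W. localize R P)"
    using contractions_not_separated Q(2) by (intro INF_superset_mono) auto
  also have "\<dots> \<subseteq> localize R Q"
    using Inter_localize_t_Max_contractions[OF t_linked_not_separated] Q(1) unfolding T_def[symmetric]
    by blast
  finally show False
    using sharp Q(1) t_sharp_domain_iff_contractions[OF t_linked_not_separated] by blast
qed

text \<open>The antichain of \<open>t\<close>-primes of \<open>T\<close> consists of those that lie over the members of \<open>W\<close>.\<close>

lemma exists_incomparable_not_separated: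
  "\<exists>\<Lambda>. incomparable_t_primes T \<Lambda> \<and> T = (\<Inter>Q\<in>\<Lambda>. localize T Q) \<and> \<Lambda> \<noteq> t_Max T"
proof -
  note L = t_linked_not_separated
  note over = t_linked_overring[OF L]
  interpret T: quotient_field_domain T using overring_domain[OF over] .
  define \<Lambda> where "\<Lambda> = {Q. t_prime T Q \<and> Q \<inter> R \<in> W}"
  have t: "t_prime T Q" if "Q \<in> \<Lambda>" for Q using that by (simp add: \<Lambda>_def)
  have img: "(\<lambda>Q. Q \<inter> R) ` \<Lambda> = W"
  proof
    show "W \<subseteq> (\<lambda>Q. Q \<inter> R) ` \<Lambda>"
    proof
      fix M assume M: "M \<in> W"
      then have "T \<subseteq> localize R M" "t_prime R M" using W_subset t_Max_t_prime by (auto simp: T_def)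
      then obtain Q where "t_prime T Q" "Q \<inter> R = M" using exists_t_prime_over[OF over] by blast
      then show "M \<in> (\<lambda>Q. Q \<inter> R) ` \<Lambda>" using M by (auto simp: \<Lambda>_def)
    qed
  qed (auto simp: \<Lambda>_def)
  have "P' = Q" if "P' \<in> \<Lambda>" "Q \<in> \<Lambda>" "P' \<subseteq> Q" for P' Q
  proof -
    have "P' \<inter> R = Q \<inter> R"
      using that img W_subset t_Max_subset_imp_eq[of "P' \<inter> R" "Q \<inter> R"] by blast
    then have "localize T P' = localize T Q" using t_linked_localize[OF L t] that by simp
    then show ?thesis using T.localize_inject T.t_prime_prime[OF t] that by blast
  qed
  then have "incomparable_t_primes T \<Lambda>"
    using t by (intro incomparable_t_primesI)
  moreover have "T = (\<Inter>Q\<in>\<Lambda>. localize T Q)"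
  proof -
    have "(\<Inter>Q\<in>\<Lambda>. localize T Q) = (\<Inter>P\<in>(\<lambda>Q. Q \<inter> R) ` \<Lambda>. localize R P)"
      using t_linked_localize[OF L t] by (simp add: image_image)
    then show ?thesis unfolding img by (simp add: T_def)
  qed
  moreover have "\<Lambda> \<noteq> t_Max T"
    using img contractions_not_separated by (auto simp: setcompr_eq_image)
  ultimately show ?thesis by blast
qed

end

end

section \<open>The equivalences\<close>

theorem proposition2p8:
  fixes R :: "'k::field set"
  assumes "domain_with_quotient_field R"
    and "PVMD R"
  shows "all_equivalent
    [ \<comment> \<open>(1)\<close>
      \<forall>T. t_flat_overring R T \<longrightarrow> t_sharp_domain T,
      \<comment> \<open>(2)\<close>
      \<forall>T. t_subintersection R T \<longrightarrow> t_sharp_domain T,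
      \<comment> \<open>(3)\<close>
      \<forall>\<Lambda>. incomparable_t_primes R \<Lambda> \<longrightarrow> v_finite R (Phi R \<Lambda>),
      \<comment> \<open>(4)\<close>
      \<forall>T. t_subintersection R T \<longrightarrow>
        (\<exists>!\<Lambda>. incomparable_t_primes R \<Lambda> \<and> T = ring_of_fractions R (Phi R \<Lambda>)) \<and>
        (\<forall>\<Lambda>. incomparable_t_primes R \<Lambda> \<and> T = ring_of_fractions R (Phi R \<Lambda>) \<longrightarrow>
             \<Lambda> = {M \<inter> R | M. M \<in> t_Max T}),
      \<comment> \<open>(5)\<close>
      \<forall>T \<Lambda>. t_flat_overring R T \<and> incomparable_t_primes T \<Lambda> \<and> T = (\<Inter>Q\<in>\<Lambda>. localize T Q) \<longrightarrow>
        \<Lambda> = t_Max T,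
      \<comment> \<open>(6)\<close>
      \<forall>\<Lambda>. \<Lambda> \<subseteq> t_Max R \<longrightarrow> v_finite R (Phi R \<Lambda>),
      \<comment> \<open>(7)\<close>
      \<forall>P. t_prime R P \<longrightarrow>
        (\<exists>J. ideal J (ring_on R) \<and> fin_gen R J \<and> J \<subseteq> P \<and>
             (\<forall>M\<in>t_Max R. \<not> P \<subseteq> M \<longrightarrow> \<not> J \<subseteq> M)),
      \<comment> \<open>(8)\<close>
      \<forall>P. t_prime R P \<longrightarrow>
        (\<exists>u. conductor R u \<subseteq> P \<and> (\<forall>M\<in>t_Max R. \<not> P \<subseteq> M \<longrightarrow> \<not> conductor R u \<subseteq> M)),
      \<comment> \<open>(9)\<close>
      \<forall>P. t_prime R P \<longrightarrow>
        \<not> (\<Inter>M\<in>{M \<in> t_Max R. \<not> P \<subseteq> M}. localize R M) \<subseteq> localize R P,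
      \<comment> \<open>(10)\<close>
      \<forall>T. t_linked_overring R T \<longrightarrow> t_sharp_domain T,
      \<comment> \<open>(11)\<close>
      \<forall>P. t_prime R P \<longrightarrow> t_sharp_domain (colon P P) ]"
    (is "all_equivalent [?s1, ?s2, ?s3, ?s4, ?s5, ?s6, ?s7, ?s8, ?s9, ?s10, ?s11]")
proof -
  interpret prufer_v_multiplication_domain R
    by unfold_locales (use assms in auto)
  have tinc: "t_prime R P" if "incomparable_t_primes R \<Lambda>" "P \<in> \<Lambda>" for \<Lambda> P
    by (rule incomparable_t_primesD[OF that])
  have fractions: "ring_of_fractions R (Phi R \<Lambda>) = (\<Inter>P\<in>\<Lambda>. localize R P)"
    if "incomparable_t_primes R \<Lambda>" for \<Lambda>
    using ring_of_fractions_Phi t_prime_prime tinc[OF that] by blast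

  have "?s3 \<Longrightarrow> ?s6" using incomparable_t_Max by blast
  moreover have "?s6 \<Longrightarrow> ?s7"
  proof (intro allI impI)
    fix P assume s6: ?s6 and P: "t_prime R P"
    let ?W = "{M \<in> t_Max R. \<not> P \<subseteq> M}"
    have PW: "P \<in> Phi R ?W" using t_prime_t_ideal[OF P] by (simp add: Phi_def)
    have v: "v_finite R (Phi R ?W)" using s6[rule_format, of ?W] by simp
    have tW: "\<forall>M\<in>?W. t_prime R M" using t_Max_t_prime by blast
    obtain F where F: "finite F" "F \<subseteq> P" "\<forall>M\<in>?W. \<not> F \<subseteq> M"
      using v_finite_PhiD[OF v tW PW] by (elim exE conjE)
    note PI = prime_ideal[OF t_prime_prime[OF P]]
    have "ideal (span_over R F) (ring_on R)"
      using F(2) ideal_subset[OF PI] by (intro ideal_span_over) blast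
    moreover have "fin_gen R (span_over R F)" using F(1) unfolding fin_gen_def by blast
    moreover have "span_over R F \<subseteq> P" using span_over_subset_iff[OF PI] F(2) by blast
    moreover have "\<forall>M\<in>t_Max R. \<not> P \<subseteq> M \<longrightarrow> \<not> span_over R F \<subseteq> M"
      using F(3) subset_span_over[of F] by blast
    ultimately show "\<exists>J. ideal J (ring_on R) \<and> fin_gen R J \<and> J \<subseteq> P \<and>
             (\<forall>M\<in>t_Max R. \<not> P \<subseteq> M \<longrightarrow> \<not> J \<subseteq> M)" by blast
  qed
  moreover have "?s7 \<Longrightarrow> ?s9"
  proof (intro allI impI)
    fix P assume s7: ?s7 and P: "t_prime R P"
    let ?W = "{M \<in> t_Max R. \<not> P \<subseteq> M}"
    obtain J where J: "fin_gen R J" "J \<subseteq> P" "\<forall>M\<in>?W. \<not> J \<subseteq> M"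
      using s7[rule_format, OF P] by blast
    then obtain F where F: "finite F" "J = span_over R F" unfolding fin_gen_def by blast
    have "\<not> F \<subseteq> M" if "M \<in> ?W" for M
      using J(3) that F(2) span_over_subset_iff[OF t_ideal_ideal[OF t_Max_t_ideal], of M F] by blast
    moreover have "F \<subseteq> P" using F(2) J(2) subset_span_over[of F] by blast
    moreover have "primeideal M (ring_on R)" if "M \<in> ?W" for M
      using that t_Max_t_prime t_prime_prime by blast
    ultimately show "\<not> (\<Inter>M\<in>?W. localize R M) \<subseteq> localize R P"
      by (intro Inter_localize_not_subset[OF P _ F(1)])
  qed
  moreover have "?s8 \<longleftrightarrow> ?s9"
  proof -
    have "(\<exists>u. conductor R u \<subseteq> P \<and> (\<forall>M\<in>t_Max R. \<not> P \<subseteq> M \<longrightarrow> \<not> conductor R u \<subseteq> M)) \<longleftrightarrow>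
        \<not> (\<Inter>M\<in>{M \<in> t_Max R. \<not> P \<subseteq> M}. localize R M) \<subseteq> localize R P" if "t_prime R P" for P
    proof -
      have A: "conductor R u \<subseteq> P \<longleftrightarrow> u \<notin> localize R P" for u
        using mem_localize_iff_conductor[OF t_ideal_ideal[OF t_prime_t_ideal[OF that]]] by simp
      have B: "(\<forall>M\<in>t_Max R. \<not> P \<subseteq> M \<longrightarrow> \<not> conductor R u \<subseteq> M) \<longleftrightarrow>
          u \<in> (\<Inter>M\<in>{M \<in> t_Max R. \<not> P \<subseteq> M}. localize R M)" for u
        using mem_localize_iff_conductor[OF t_ideal_ideal[OF t_Max_t_ideal]] by auto
      show ?thesis unfolding A B by (simp only: subset_iff not_all not_imp conj_commute)
    qed
    then show ?thesis by simp
  qed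
  moreover have "?s9 \<Longrightarrow> ?s3"
  proof (intro allI impI)
    fix \<Lambda> assume s9: ?s9 and \<Lambda>: "incomparable_t_primes R \<Lambda>"
    have part: "\<exists>F. finite F \<and> F \<subseteq> P \<and> (\<forall>M\<in>t_Max R. \<not> P \<subseteq> M \<longrightarrow> \<not> F \<subseteq> M)" if P: "t_prime R P" for P
    proof -
      obtain u where u: "u \<notin> localize R P" "\<And>M. M \<in> t_Max R \<Longrightarrow> \<not> P \<subseteq> M \<Longrightarrow> u \<in> localize R M"
        using s9[rule_format, OF P] by blast
      obtain G where G: "finite G" "G \<subseteq> conductor R u"
          "\<forall>M\<in>t_Max R. u \<in> localize R M \<longrightarrow> \<not> G \<subseteq> M"
        using exists_finite_subset_conductor[of u] by (elim exE conjE)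
      have "G \<subseteq> P"
        using G(2) u(1) mem_localize_iff_conductor[OF t_ideal_ideal[OF t_prime_t_ideal[OF P]]] by blast
      then show ?thesis using G(1,3) u(2) by (intro exI[of _ G]) simp
    qed
    have "\<forall>I\<in>Phi R \<Lambda>. \<exists>F. finite F \<and> F \<subseteq> I \<and> (\<forall>P\<in>\<Lambda>. \<not> F \<subseteq> P)"
      by (rule ballI, rule incomparable_t_primes_finite_escape[OF part \<Lambda>])
    then show "v_finite R (Phi R \<Lambda>)" using v_finite_Phi_iff[of \<Lambda>] tinc[OF \<Lambda>] by simp
  qed
  \<comment> \<open>a \<open>t\<close>-prime that violates (9) would give a ring \<open>\<Inter>R\<^sub>M\<close> for which each of the statements on
    overrings fails\<close>
  moreover have "?s1 \<longleftrightarrow> ?s10" "?s2 \<longleftrightarrow> ?s10"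
    by (simp_all only: t_flat_overring_iff_t_linked t_subintersection_iff_t_linked)
  moreover have "?s3 \<Longrightarrow> ?s10" using t_sharp_domain_if_v_finite by simp
  moreover have "?s10 \<Longrightarrow> ?s11" using t_linked_colon by simp
  moreover have "?s11 \<Longrightarrow> ?s9"
    using not_t_sharp_domain_not_separated colon_self_not_separated by fastforce
  moreover have "?s3 \<Longrightarrow> ?s4"
  proof (intro allI impI)
    fix T assume s3: ?s3 and "t_subintersection R T"
    then have L: "t_linked_overring R T" by (simp add: t_subintersection_iff_t_linked)
    let ?C = "t_Max_contractions R T"
    have inc: "incomparable_t_primes R ?C" by (rule incomparable_t_Max_contractions[OF L])
    have "T = ring_of_fractions R (Phi R ?C)"
      using fractions[OF inc] Inter_localize_t_Max_contractions[OF L] by simp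
    moreover have uniq: "\<forall>\<Lambda>. incomparable_t_primes R \<Lambda> \<and> T = ring_of_fractions R (Phi R \<Lambda>) \<longrightarrow> \<Lambda> = ?C"
    proof (intro allI impI, elim conjE)
      fix \<Lambda> assume \<Lambda>: "incomparable_t_primes R \<Lambda>" and "T = ring_of_fractions R (Phi R \<Lambda>)"
      then have "T = (\<Inter>P\<in>\<Lambda>. localize R P)" using fractions by simp
      then show "\<Lambda> = ?C" using incomparable_eq_t_Max_contractions[OF L \<Lambda>] s3 \<Lambda> by blast
    qed
    ultimately show "(\<exists>!\<Lambda>. incomparable_t_primes R \<Lambda> \<and> T = ring_of_fractions R (Phi R \<Lambda>)) \<and>
        (\<forall>\<Lambda>. incomparable_t_primes R \<Lambda> \<and> T = ring_of_fractions R (Phi R \<Lambda>) \<longrightarrow>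
             \<Lambda> = {M \<inter> R | M. M \<in> t_Max T})"
      using inc by (intro conjI ex1I[of _ ?C]) blast+
  qed
  moreover have "?s4 \<Longrightarrow> ?s9"
  proof (intro allI impI notI)
    fix P assume s4: ?s4 and P: "t_prime R P"
    let ?W = "{M \<in> t_Max R. \<not> P \<subseteq> M}"
    let ?T = "\<Inter>M\<in>?W. localize R M"
    assume sub: "?T \<subseteq> localize R P"
    have inc: "incomparable_t_primes R ?W" by (rule incomparable_t_Max) blast
    have "t_subintersection R ?T"
      using t_linked_not_separated[OF P sub] by (simp add: t_subintersection_iff_t_linked)
    from conjunct2[OF s4[rule_format, OF this]]
    have "incomparable_t_primes R ?W \<and> ?T = ring_of_fractions R (Phi R ?W) \<longrightarrow>
        ?W = t_Max_contractions R ?T"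
      by (rule spec)
    then have "?W = t_Max_contractions R ?T" using inc fractions[OF inc] by simp
    then show False using contractions_not_separated[OF P sub] by simp
  qed
  moreover have "?s3 \<Longrightarrow> ?s5"
    unfolding t_flat_overring_iff_t_linked
  proof (intro allI impI, elim conjE)
    fix T \<Lambda> assume s3: ?s3 and L: "t_linked_overring R T"
      and \<Lambda>: "incomparable_t_primes T \<Lambda>" "T = (\<Inter>Q\<in>\<Lambda>. localize T Q)"
    show "\<Lambda> = t_Max T" by (rule t_flat_incomparable_eq_t_Max[OF L s3[rule_format] \<Lambda>])
  qed
  moreover have "?s5 \<Longrightarrow> ?s9"
    unfolding t_flat_overring_iff_t_linked
  proof (intro allI impI notI)
    fix P assume s5: "\<forall>T \<Lambda>. t_linked_overring R T \<and> incomparable_t_primes T \<Lambda> \<and>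
        T = (\<Inter>Q\<in>\<Lambda>. localize T Q) \<longrightarrow> \<Lambda> = t_Max T" and P: "t_prime R P"
    let ?T = "\<Inter>M\<in>{M \<in> t_Max R. \<not> P \<subseteq> M}. localize R M"
    assume sub: "?T \<subseteq> localize R P"
    obtain \<Lambda> where "incomparable_t_primes ?T \<Lambda>" "?T = (\<Inter>Q\<in>\<Lambda>. localize ?T Q)" "\<Lambda> \<noteq> t_Max ?T"
      using exists_incomparable_not_separated[OF P sub] by (elim exE conjE)
    then show False using s5[rule_format, of ?T \<Lambda>] t_linked_not_separated[OF P sub] by simp
  qed
  ultimately have "?s1 = ?s3" "?s2 = ?s3" "?s4 = ?s3" "?s5 = ?s3" "?s6 = ?s3" "?s7 = ?s3" "?s8 = ?s3"
      "?s9 = ?s3" "?s10 = ?s3" "?s11 = ?s3"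
    by argo+
  then show ?thesis unfolding all_equivalent_def by simp
qed

end
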